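(* Let $n\ge1$, let $a_1,\dots,a_{n-1},b_1,\dots,b_{n-1}$ be complex parameters of modulus strictly less than $1$, and define the $q$-difference operator, acting on functions of $x_1,\dots,x_n$, $$\mathfrak{D}_{\boldsymbol b}=\sum_{i=1}^n\ \prod_{r=1}^{n-1}(1-x_ib_r)\prod_{\substack{j=1\\ j\ne i}}^n\frac1{1-x_i/x_j}\ T_{q,x_i},$$ where $T_{q,x_i}$ replaces $x_i$ by $qx_i$. Then for every $\lambda\in\mathbb{Y}_n$, $$\mathfrak{D}_{\boldsymbol b}\,\mathsf f_\lambda(x_1,\dots,x_n|a_1,\dots,a_{n-1};b_1,\dots,b_{n-1})=q^{\lambda_n}\,\mathsf f_\lambda(x_1,\dots,x_n|a_1,\dots,a_{n-1};b_1,\dots,b_{n-1}).$$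
   Context: Let $q\in\mathbb{C}$ with $|q|<1$, and $(z;q)_k=\prod_{i=0}^{k-1}(1-zq^i)$ for $k\in\mathbb{Z}_{\ge0}$. $\mathbb{Y}_n$ is the set of integer partitions $\lambda=(\lambda_1\ge\dots\ge\lambda_n\ge0)$ with at most $n$ nonzero parts, with $\lambda_i=0$ for $i>n$; $|\lambda|=\sum_i\lambda_i$. For partitions, $\mu\preceq\lambda$ means $\lambda_i\ge\mu_i\ge\lambda_{i+1}$ for all $i\ge1$. Spin $q$-Whittaker polynomials: let $c_1,\dots,c_n,d_1,\dots,d_n$ be complex parameters of modulus $<1$. For $\lambda\in\mathbb{Y}_n$, $\mu\in\mathbb{Y}_{n-1}$ set $$\mathbb{F}_{\lambda/\mu}(x|c_1,\dots,c_n;d_1,\dots,d_n)=\mathbf 1_{\mu\preceq\lambda}\,x^{|\lambda|-|\mu|}\prod_{r=1}^n\frac{(c_r/x;q)_{\lambda_r-\mu_r}(xd_r;q)_{\mu_r-\lambda_{r+1}}(q;q)_{\lambda_r-\lambda_{r+1}}}{(q;q)_{\lambda_r-\mu_r}(q;q)_{\mu_r-\lambda_{r+1}}(c_rd_r;q)_{\lambda_r-\lambda_{r+1}}}.$$ Define recursively, starting from $\mathbb{F}_\varnothing=1$ in zero variables, $$\mathbb{F}_\lambda(x_1,\dots,x_n|c_1,\dots,c_n;d_1,\dots,d_n)=\sum_{\mu\in\mathbb{Y}_{n-1},\,\mu\preceq\lambda}\mathbb{F}_\mu(x_1,\dots,x_{n-1}|c_2,\dots,c_n;d_1,\dots,d_{n-1})\,\mathbb{F}_{\lambda/\mu}(x_n|c_1,\dots,c_n;d_1,\dots,d_n).$$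 These are polynomials, known to be symmetric in $x_1,\dots,x_n$. Set $$\mathsf f_\lambda(x_1,\dots,x_n|c_1,\dots,c_{n-1};d_1,\dots,d_{n-1})=\mathbb{F}_\lambda(x_1,\dots,x_n|c_1,\dots,c_{n-1},0;d_1,\dots,d_n),$$ which does not depend on $d_n$. *)

theory Defs
  imports Complex_Main
begin

text \<open>
  Indices are shifted to start at 0: the parts, variables and parameters
  \<open>\<lambda>\<^sub>1, x\<^sub>1, c\<^sub>1, d\<^sub>1, \<dots>\<close> are \<open>\<lambda> 0, x 0, c 0, d 0, \<dots>\<close>.  Families of variables and
  parameters are functions on \<open>nat\<close> of which only finitely many entries are relevant.
\<close>

definition qpoch :: "complex \<Rightarrow> complex \<Rightarrow> nat \<Rightarrow> complex" where
  "qpoch z q k = (\<Prod>i<k. 1 - z * q ^ i)"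

definition partitions :: "nat \<Rightarrow> (nat \<Rightarrow> nat) set" where
  "partitions n = {l. (\<forall>i. l (Suc i) \<le> l i) \<and> (\<forall>i\<ge>n. l i = 0)}"

definition interlaces :: "(nat \<Rightarrow> nat) \<Rightarrow> (nat \<Rightarrow> nat) \<Rightarrow> bool" where
  "interlaces m l \<longleftrightarrow> (\<forall>i. m i \<le> l i \<and> l (Suc i) \<le> m i)"

text \<open>
  The skew polynomial in one variable.  For \<open>x \<noteq> 0\<close> it is the usual formula containing
  \<open>x ^ (|\<lambda>| - |\<mu>|)\<close> and \<open>(c\<^sub>r/x; q)\<close>, see \<open>spin_skew_eq\<close> below.  The powers of \<open>x\<close> are
  distributed over the factors here, \<open>x ^ k (c/x; q)\<^sub>k = \<Prod>i<k. (x - c q ^ i)\<close>, so that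
  the value at \<open>x = 0\<close> is the value of the polynomial (and not an artefact of \<open>c / 0 = 0\<close>).
  That value is needed because \<open>q = 0\<close> is allowed.
\<close>

definition spin_skew ::
  "complex \<Rightarrow> nat \<Rightarrow> (nat \<Rightarrow> nat) \<Rightarrow> (nat \<Rightarrow> nat) \<Rightarrow> complex \<Rightarrow>
   (nat \<Rightarrow> complex) \<Rightarrow> (nat \<Rightarrow> complex) \<Rightarrow> complex" where
  "spin_skew q n l m x c d =
     (if interlaces m l then
        (\<Prod>r<n. (\<Prod>i<l r - m r. x - c r * q ^ i) * qpoch (x * d r) q (m r - l (Suc r))
                  * qpoch q q (l r - l (Suc r))
                / (qpoch q q (l r - m r) * qpoch q q (m r - l (Suc r))
                  * qpoch (c r * d r) q (l r - l (Suc r))))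
      else 0)"

lemma qpoch_homogeneous:
  assumes "x \<noteq> 0"
  shows "(\<Prod>i<k. x - c * q ^ i) = x ^ k * qpoch (c / x) q k"
  using assms by (induction k) (simp_all add: qpoch_def field_simps)

lemma spin_skew_eq:
  assumes "x \<noteq> 0" "l \<in> partitions n" "m \<in> partitions (n - 1)"
  shows "spin_skew q n l m x c d =
     (if interlaces m l then 1 else 0) * x ^ ((\<Sum>i<n. l i) - (\<Sum>i<n - 1. m i)) *
       (\<Prod>r<n. qpoch (c r / x) q (l r - m r) * qpoch (x * d r) q (m r - l (Suc r))
                  * qpoch q q (l r - l (Suc r))
                / (qpoch q q (l r - m r) * qpoch q q (m r - l (Suc r))
                  * qpoch (c r * d r) q (l r - l (Suc r))))"
proof (cases "interlaces m l")
  case True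
  have "(\<Sum>i<n - 1. m i) = (\<Sum>i<n. m i)"
    using assms(3) by (intro sum.mono_neutral_left) (auto simp: partitions_def)
  moreover have "(\<Sum>i<n. l i) - (\<Sum>i<n. m i) = (\<Sum>i<n. l i - m i)"
    using True by (simp add: sum_subtractf_nat interlaces_def)
  ultimately have "x ^ ((\<Sum>i<n. l i) - (\<Sum>i<n - 1. m i)) = (\<Prod>r<n. x ^ (l r - m r))"
    by (simp add: power_sum)
  then show ?thesis
    using True assms(1)
    by (simp add: spin_skew_def qpoch_homogeneous prod.distrib[symmetric] mult.assoc)
qed (simp add: spin_skew_def)

primrec spin_whittaker ::
  "complex \<Rightarrow> nat \<Rightarrow> (nat \<Rightarrow> nat) \<Rightarrow> (nat \<Rightarrow> complex) \<Rightarrow>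
   (nat \<Rightarrow> complex) \<Rightarrow> (nat \<Rightarrow> complex) \<Rightarrow> complex" where
  "spin_whittaker q 0 l x c d = 1"
| "spin_whittaker q (Suc n) l x c d =
     (\<Sum>m \<in> {m \<in> partitions n. interlaces m l}.
        spin_whittaker q n m x (\<lambda>i. c (Suc i)) d * spin_skew q (Suc n) l m (x n) c d)"

lemma finite_interlacing: "finite {m \<in> partitions n. interlaces m l}"
proof (rule finite_subset)
  let ?S = "{m. \<forall>i. (i \<in> {..<n} \<longrightarrow> m i \<in> {..Max (l ` {..<n})}) \<and> (i \<notin> {..<n} \<longrightarrow> m i = 0)}"
  show "finite ?S"
    by (rule finite_set_of_finite_funs) auto
  show "{m \<in> partitions n. interlaces m l} \<subseteq> ?S"
  proof (intro subsetI CollectI allI conjI impI)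
    fix m i
    assume m: "m \<in> {m \<in> partitions n. interlaces m l}" and "i \<in> {..<n}"
    then have "l i \<le> Max (l ` {..<n})"
      by (intro Max_ge) auto
    moreover have "m i \<le> l i"
      using m by (simp add: interlaces_def)
    ultimately show "m i \<in> {..Max (l ` {..<n})}"
      by simp
  qed (auto simp: partitions_def)
qed

text \<open>
  The parameter \<open>c\<^sub>n\<close> is set to 0.  The last parameter \<open>d\<^sub>n\<close> is the entry \<open>b (n - 1)\<close>,
  on which the value does not depend (\<open>spin_whittaker_f_cong\<close>).
\<close>

definition spin_whittaker_f ::
  "complex \<Rightarrow> nat \<Rightarrow> (nat \<Rightarrow> nat) \<Rightarrow> (nat \<Rightarrow> complex) \<Rightarrow>
   (nat \<Rightarrow> complex) \<Rightarrow> (nat \<Rightarrow> complex) \<Rightarrow> complex" where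
  "spin_whittaker_f q n l x a b = spin_whittaker q n l x (a(n - 1 := 0)) b"

lemma spin_skew_cong:
  assumes "\<And>r. r < n \<Longrightarrow> d r = d' r"
  shows "spin_skew q n l m x c d = spin_skew q n l m x c d'"
  using assms by (simp add: spin_skew_def)

lemma spin_whittaker_cong:
  assumes "\<And>r. r < n \<Longrightarrow> d r = d' r"
  shows "spin_whittaker q n l x c d = spin_whittaker q n l x c d'"
  using assms
proof (induction n arbitrary: l c)
  case (Suc n)
  have "spin_whittaker q n m x c' d = spin_whittaker q n m x c' d'" for m c'
    using Suc by simp
  moreover have "spin_skew q (Suc n) l m y c d = spin_skew q (Suc n) l m y c d'" for m y
    using Suc.prems by (rule spin_skew_cong)
  ultimately show ?case by simp
qed simp

lemma spin_whittaker_f_cong: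
  assumes "l \<in> partitions n" and "\<And>r. r < n - 1 \<Longrightarrow> b r = b' r"
  shows "spin_whittaker_f q n l x a b = spin_whittaker_f q n l x a b'"
proof (cases n)
  case (Suc k)
  have "spin_whittaker q k m x c b = spin_whittaker q k m x c b'" for m c
    using assms(2) Suc by (intro spin_whittaker_cong) simp
  moreover have "spin_skew q n l m y (a(k := 0)) b = spin_skew q n l m y (a(k := 0)) b'"
    if "m \<in> partitions k" for m y
    using that assms Suc
    by (auto simp: spin_skew_def partitions_def qpoch_def)
  ultimately show ?thesis
    using Suc by (simp add: spin_whittaker_f_def)
qed (simp add: spin_whittaker_f_def)

definition q_shift ::
  "complex \<Rightarrow> nat \<Rightarrow> ((nat \<Rightarrow> complex) \<Rightarrow> complex) \<Rightarrow> (nat \<Rightarrow> complex) \<Rightarrow> complex" where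
  "q_shift q i f x = f (x(i := q * x i))"

definition q_difference ::
  "complex \<Rightarrow> nat \<Rightarrow> (nat \<Rightarrow> complex) \<Rightarrow>
   ((nat \<Rightarrow> complex) \<Rightarrow> complex) \<Rightarrow> (nat \<Rightarrow> complex) \<Rightarrow> complex" where
  "q_difference q n b f x =
     (\<Sum>i<n. (\<Prod>r<n - 1. 1 - x i * b r) * (\<Prod>j\<in>{..<n} - {i}. 1 / (1 - x i / x j))
             * q_shift q i f x)"

end

theory Submission
  imports Defs "HOL-Computational_Algebra.Polynomial"
begin

text \<open>
  Write \<open>F\<^sub>\<lambda>\<close> for the polynomial with parameters \<open>a\<close>, \<open>b\<close> in the theorem, and \<open>T\<^sub>i\<close> for the
  shift of \<open>x\<^sub>i\<close> to \<open>q x\<^sub>i\<close>.  The idea is to trade the shifts of the variables for an operator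
  that acts on the partition.  For a number \<open>z\<close>, consider the sums \<open>C(z; \<lambda>)\<close> and \<open>B(z; \<lambda>)\<close> of
  \<open>weight \<sqdot> F\<^bsub>\<lambda> + \<eta>\<^esub>\<close> over all ways \<open>\<eta> \<in> {0,1}\<^sup>n\<close> to add at most one box to each
  row of \<open>\<lambda>\<close>, where the last row receives a box in \<open>C\<close> and none in \<open>B\<close>.  The weight is a
  product of factors \<open>box_weight\<close> that depend on two adjacent rows, and is a polynomial in \<open>z\<close>
  of degree at most \<open>n - 1\<close>.  In the language of integrable systems, \<open>B\<close> and \<open>C\<close> are entries
  of a monodromy matrix (\<open>strip_sum\<close>), and the variables \<open>x\<^sub>i\<close> are separated variables for it:

    \<^item> \<open>C(z; \<lambda>) - z B(z; \<lambda>) = \<Prod>\<^sub>j (x\<^sub>j - z) F\<^sub>\<lambda>\<close>, a Pieri rule (\<open>prod_times_spin_whittaker\<close>);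
    \<^item> at \<open>z = x\<^sub>i\<close>, the sum \<open>q\<^bsup>\<lambda>\<^sub>n\<^esup> C(x\<^sub>i; \<lambda>)\<close> is \<open>\<Prod>\<^sub>j x\<^sub>j \<Prod>\<^sub>r (1 - x\<^sub>i b\<^sub>r) T\<^sub>i F\<^sub>\<lambda>\<close>
      (\<open>strip_sum_at_variable\<close>).

  By the second fact, \<open>\<Prod>\<^sub>j x\<^sub>j\<close> times the left-hand side of the theorem is \<open>q\<^bsup>\<lambda>\<^sub>n\<^esup>\<close> times
  the Lagrange interpolation formula for \<open>C(0; \<lambda>)\<close> with nodes \<open>x\<^sub>1, \<dots>, x\<^sub>n\<close>.  By the first
  fact at \<open>z = 0\<close>, \<open>C(0; \<lambda>) = \<Prod>\<^sub>j x\<^sub>j F\<^sub>\<lambda>\<close>.  Dividing by \<open>\<Prod>\<^sub>j x\<^sub>j\<close> gives the theorem.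
  For \<open>n = 1\<close>, where \<open>x\<^sub>1\<close> may be 0, it is read off from \<open>F\<^sub>\<lambda> = x\<^sub>1\<^bsup>\<lambda>\<^sub>1\<^esup>\<close>.

  Both facts are proved by induction on \<open>n\<close>.  The branching rule writes \<open>B\<close> and \<open>C\<close> for \<open>n\<close>
  variables as combinations of those for \<open>n - 1\<close> variables (\<open>strip_sum_Suc\<close>), and this
  recursion carries the whole proof.  It says that adding boxes to \<open>\<lambda>\<close> and then branching is
  the same as branching and then adding boxes to \<open>\<mu>\<close>.  The coefficient of a fixed polynomial
  in \<open>n - 1\<close> variables is on both sides a product of 2 by 2 transfer matrices along the rows,
  and the two products are related by moving a \<open>gauge\<close> matrix through one row at a time
  (\<open>local_exchange\<close>).  Given the recursion, the Pieri rule is immediate.  The case \<open>i < n\<close> of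
  the second fact follows because the Pieri product vanishes at \<open>z = x\<^sub>i\<close>, and the case \<open>i = n\<close>
  because the transfer matrices degenerate at \<open>z = x\<^sub>n\<close>.
\<close>

section \<open>Factors of the skew polynomials\<close>

text \<open>
  The two families of factors of a skew polynomial, \<open>x\<^sup>k (c/x; q)\<^sub>k / (q; q)\<^sub>k\<close> for
  \<open>k = \<lambda>\<^sub>r - \<mu>\<^sub>r\<close> and \<open>(x d; q)\<^sub>k / (q; q)\<^sub>k\<close> for \<open>k = \<mu>\<^sub>r - \<lambda>\<^bsub>r+1\<^esub>\<close>.  They are extended by 0 to
  negative integers, so that their product over all rows vanishes when interlacing fails.  The
  factors \<open>(q; q)\<^sub>k / (cd; q)\<^sub>k\<close> for \<open>k = \<lambda>\<^sub>r - \<lambda>\<^bsub>r+1\<^esub>\<close> are kept apart as \<open>gap_weight\<close>.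
\<close>

definition up_weight :: "complex \<Rightarrow> complex \<Rightarrow> complex \<Rightarrow> int \<Rightarrow> complex" where
  "up_weight q c x k = (if k < 0 then 0 else (\<Prod>i<nat k. x - c * q ^ i) / qpoch q q (nat k))"

definition down_weight :: "complex \<Rightarrow> complex \<Rightarrow> complex \<Rightarrow> int \<Rightarrow> complex" where
  "down_weight q d x k = (if k < 0 then 0 else qpoch (x * d) q (nat k) / qpoch q q (nat k))"

definition gap_weight :: "complex \<Rightarrow> complex \<Rightarrow> nat \<Rightarrow> complex" where
  "gap_weight q e k = qpoch q q k / qpoch e q k"

text \<open>
  Here \<open>k = \<lambda>\<^sub>r - \<lambda>\<^bsub>r+1\<^esub>\<close>, and \<open>s\<close>, \<open>t\<close> tell whether the rows \<open>r\<close> and \<open>r + 1\<close> receive a box.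
  These weights can be read off from the three-term recurrence in \<open>k\<close> of the polynomials in two
  variables, whose generating function \<open>\<Sum>\<^sub>k (cd)\<^sub>k / (q)\<^sub>k g\<^sub>k u\<^sup>k\<close> is
  \<open>(cu)\<^sub>\<infinity> (x\<^sub>1x\<^sub>2du)\<^sub>\<infinity> / ((x\<^sub>1u)\<^sub>\<infinity> (x\<^sub>2u)\<^sub>\<infinity>)\<close>.  The weight for \<open>s\<close> false, \<open>t\<close> true vanishes at \<open>k = 0\<close>,
  where adding the box would not give a partition.
\<close>

definition box_weight :: "complex \<Rightarrow> complex \<Rightarrow> complex \<Rightarrow> complex \<Rightarrow> bool \<Rightarrow> bool \<Rightarrow> nat \<Rightarrow> complex" where
  "box_weight q z c d s t k =
     (if s then if t then 1 - z * d * q ^ k else 1 - c * d * q ^ k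
      else if t then - z * (1 - q ^ k) else c * q ^ k - z)"

text \<open>
  The matrix that is moved through the rows.  Its entries depend on \<open>m = \<mu>\<^sub>r - \<lambda>\<^bsub>r+1\<^esub>\<close>; \<open>s\<close> tells
  whether row \<open>r\<close> of \<open>\<mu>\<close> receives a box and \<open>t\<close> whether row \<open>r + 1\<close> of \<open>\<lambda>\<close> does.
\<close>

definition gauge :: "complex \<Rightarrow> complex \<Rightarrow> complex \<Rightarrow> complex \<Rightarrow> bool \<Rightarrow> bool \<Rightarrow> nat \<Rightarrow> complex" where
  "gauge q z x d s t m =
     (if s then if t then 1 - z * d * q ^ m else 1 - x * d * q ^ m
      else if t then - z * (1 - q ^ m) else x * q ^ m - z)"

lemma qpoch_0 [simp]: "qpoch z q 0 = 1" by (simp add: qpoch_def)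

lemma qpoch_Suc: "qpoch z q (Suc k) = qpoch z q k * (1 - z * q ^ k)" by (simp add: qpoch_def)

lemma qpoch_nonzero:
  assumes "norm q < 1" "norm z < 1" shows "qpoch z q k \<noteq> 0"
proof -
  have "norm (z * q ^ i) < 1" for i
  proof -
    have "norm q ^ i \<le> 1" using assms(1) by (intro power_le_one) auto
    then have "norm z * norm q ^ i \<le> norm z" by (intro mult_left_le) auto
    with assms(2) show ?thesis by (simp add: norm_mult norm_power)
  qed
  then have "1 - z * q ^ i \<noteq> 0" for i by (metis norm_one eq_iff_diff_eq_0 less_irrefl)
  then show ?thesis by (simp add: qpoch_def)
qed

lemma up_weight_neg [simp]: "k < 0 \<Longrightarrow> up_weight q c x k = 0" by (simp add: up_weight_def)

lemma down_weight_neg [simp]: "k < 0 \<Longrightarrow> down_weight q d x k = 0" by (simp add: down_weight_def)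

lemma up_weight_0 [simp]: "up_weight q c x 0 = 1" by (simp add: up_weight_def)

lemma down_weight_0 [simp]: "down_weight q d x 0 = 1" by (simp add: down_weight_def)

lemma up_weight_rec:
  assumes "norm q < 1"
  shows "(1 - q * q ^ k) * up_weight q c x (1 + int k) = (x - c * q ^ k) * up_weight q c x (int k)"
proof -
  have *: "nat (1 + int k) = Suc k" by simp
  have "qpoch q q (Suc k) \<noteq> 0" "qpoch q q k \<noteq> 0" using assms by (simp_all add: qpoch_nonzero)
  then show ?thesis unfolding up_weight_def * by (simp add: qpoch_Suc)
qed

lemma down_weight_rec:
  assumes "norm q < 1"
  shows "(1 - q * q ^ k) * down_weight q d x (1 + int k) = (1 - x * d * q ^ k) * down_weight q d x (int k)"
proof -
  have *: "nat (1 + int k) = Suc k" by simp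
  have "qpoch q q (Suc k) \<noteq> 0" "qpoch q q k \<noteq> 0" using assms by (simp_all add: qpoch_nonzero)
  then show ?thesis unfolding down_weight_def * by (simp add: qpoch_Suc)
qed

lemma gap_weight_rec:
  assumes "norm q < 1" "norm e < 1"
  shows "(1 - e * q ^ k) * gap_weight q e (Suc k) = (1 - q * q ^ k) * gap_weight q e k"
proof -
  have "qpoch e q (Suc k) \<noteq> 0" "qpoch e q k \<noteq> 0" using assms by (simp_all add: qpoch_nonzero)
  then show ?thesis unfolding gap_weight_def by (simp add: qpoch_Suc)
qed

section \<open>The local exchange relation\<close>

text \<open>
  Rows \<open>r\<close> and \<open>r + 1\<close> of \<open>\<lambda>\<close> have lengths \<open>a\<close> and \<open>b\<close>, and row \<open>r\<close> of the smaller partition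
  \<open>\<kappa>\<close> has length \<open>k\<close>.  Adding boxes to \<open>\<lambda>\<close> and then branching to \<open>\<kappa>\<close> contributes
  \<open>strip_row_factor\<close> in row \<open>r\<close>.  For the opposite order, \<open>row_factor\<close> is the branching factor
  from \<open>\<lambda>\<close> to the partition \<open>\<mu>\<close> that becomes \<open>\<kappa>\<close> by adding boxes; it takes
  \<open>k\<close> rather than \<open>k - 1\<close> as argument to stay meaningful if \<open>k = 0\<close>.
\<close>

definition strip_row_factor :: "complex \<Rightarrow> complex \<Rightarrow> complex \<Rightarrow> complex \<Rightarrow> complex \<Rightarrow>
    bool \<Rightarrow> bool \<Rightarrow> nat \<Rightarrow> nat \<Rightarrow> nat \<Rightarrow> complex" where
  "strip_row_factor q z x c d s t a b k = box_weight q z c d s t (a - b)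
      * gap_weight q (c * d) (a + of_bool s - (b + of_bool t))
      * up_weight q c x (int a + of_bool s - int k) * down_weight q d x (int k - int b - of_bool t)"

definition row_factor :: "complex \<Rightarrow> complex \<Rightarrow> complex \<Rightarrow> complex \<Rightarrow>
    bool \<Rightarrow> nat \<Rightarrow> nat \<Rightarrow> nat \<Rightarrow> complex" where
  "row_factor q x c d s a b k = gap_weight q (c * d) (a - b)
      * up_weight q c x (int a - int k + of_bool s) * down_weight q d x (int k - of_bool s - int b)"

text \<open>
  Changing the gap between the rows changes \<open>gap_weight\<close> by a rational factor whose denominator
  is cancelled by \<open>box_weight\<close>.  The exponent \<open>a - b - 1\<close> is truncated only if \<open>a = b\<close>, and then
  one of the last two factors is 0.
\<close>

lemma strip_row_factor_eq:
  assumes "norm q < 1" "norm (c * d) < 1" "b \<le> a"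
  shows "strip_row_factor q z x c d s t a b k = gap_weight q (c * d) (a - b)
     * (if s then if t then 1 - z * d * q ^ (a - b) else 1 - q ^ Suc (a - b)
        else if t then - z * (1 - c * d * q ^ (a - b - 1)) else c * q ^ (a - b) - z)
      * up_weight q c x (int a + of_bool s - int k) * down_weight q d x (int k - int b - of_bool t)"
proof -
  consider "s = t" | "s" "\<not> t" | "\<not> s" "t" "a = b" | "\<not> s" "t" "b < a"
    using assms(3) by fastforce
  then show ?thesis
  proof cases
    case 1
    then show ?thesis by (simp add: strip_row_factor_def box_weight_def)
  next
    case 2
    have "a + 1 - b = Suc (a - b)" using assms(3) by simp
    then show ?thesis using 2 gap_weight_rec[OF assms(1,2), of "a - b"]
      by (simp add: strip_row_factor_def box_weight_def)
  next
    case 3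
    have "int a - int k < 0 \<or> int k - int b - 1 < 0" using 3 by linarith
    then have "up_weight q c x (int a - int k) * down_weight q d x (int k - int b - 1) = 0" by auto
    with 3 show ?thesis by (auto simp: strip_row_factor_def)
  next
    case 4
    then obtain k' where k': "a - b = Suc k'" by (metis Suc_diff_Suc)
    moreover from k' have "a - Suc b = k'" by simp
    ultimately show ?thesis using 4 gap_weight_rec[OF assms(1,2), of k']
      by (simp add: strip_row_factor_def box_weight_def mult.commute)
  qed
qed

text \<open>
  After \<open>strip_row_factor_eq\<close> both sides are polynomial expressions in two consecutive values of
  \<open>up_weight\<close>, two consecutive values of \<open>down_weight\<close> and some powers of \<open>q\<close>.  The relation is an
  algebraic consequence of the two recurrences, one for each pair of consecutive values.  The case
  distinction separates the boundary values of \<open>k\<close>, at which one value of a pair is an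
  extension by 0.
\<close>

lemma local_exchange:
  assumes q: "norm q < 1" "norm (c * e) < 1" and "b \<le> a"
  shows "(\<Sum>t\<in>UNIV. gauge q z x d s t m * strip_row_factor q z x c e t u a b k)
     = (\<Sum>t\<in>UNIV. box_weight q z c d s t (nat (int m + (int a - int k) + of_bool t)) * row_factor q x c e t a b k
          * gauge q z x e t u (nat (int k - of_bool t - int b)))"
proof -
  define M where "M = q ^ m"
  consider "a + 1 < k" | "k < b" | "k = b" | "k = a + 1" "b < k" | "k \<le> a" "b < k" by linarith
  then show ?thesis
  proof cases
    case 1
    then show ?thesis by (simp add: strip_row_factor_eq[OF assms] row_factor_def UNIV_bool)
  next
    case 2
    then show ?thesis by (simp add: strip_row_factor_eq[OF assms] row_factor_def UNIV_bool)
  next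
    case 3
    with assms(3) obtain i where a: "a = b + i" by (metis le_Suc_ex)
    \<comment> \<open>With the powers of \<open>q\<close> as opaque constants, what remains is polynomial ideal membership.\<close>
    define P where "P = q ^ i"
    define U where "U = up_weight q c x (int i)"
    define U' where "U' = up_weight q c x (1 + int i)"
    have rec: "(1 - q * q ^ i) * U' = (x - c * q ^ i) * U"
      unfolding U_def U'_def by (rule up_weight_rec[OF q(1)])
    have n: "nat (int m + 1 + int i) = Suc (m + i)" "nat (int m + int i) = m + i"
       "nat (int m + int i + 1) = Suc (m + i)"
       "nat (int i + int m) = m + i" "nat (1 + (int i + int m)) = Suc (m + i)" "nat (int i + (1 + int m)) = Suc (m + i)" by simp_all
    define N where "N = gap_weight q (c * e) i"
    show ?thesis using rec[folded P_def] unfolding 3 a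
      by (cases s; cases u) (simp_all add: strip_row_factor_eq[OF q] row_factor_def UNIV_bool box_weight_def
          gauge_def n power_add mult_ac add.commute
          del: mult_cancel_left mult_cancel_right flip: M_def P_def N_def U_def U'_def, algebra+)
  next
    case 4
    then obtain j where k: "k = Suc (b + j)" by (metis less_iff_Suc_add)
    with 4 have a: "a = b + j" by simp
    define R where "R = q ^ j"
    define V where "V = down_weight q e x (int j)"
    define V' where "V' = down_weight q e x (1 + int j)"
    have rec: "(1 - q * q ^ j) * V' = (1 - x * e * q ^ j) * V"
      unfolding V_def V'_def by (rule down_weight_rec[OF q(1)])
    define N where "N = gap_weight q (c * e) j"
    show ?thesis using rec[folded R_def] unfolding k a
      by (cases s; cases u) (simp_all add: strip_row_factor_eq[OF q] row_factor_def UNIV_bool box_weight_def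
          gauge_def power_add mult_ac add.commute
          del: mult_cancel_left mult_cancel_right flip: M_def R_def N_def V_def V'_def)
  next
    case 5
    then obtain i j where k: "k = Suc (b + j)" and a: "a = Suc (b + j) + i" by (metis less_iff_Suc_add le_Suc_ex)
    define P where "P = q ^ i"
    define U where "U = up_weight q c x (int i)"
    define U' where "U' = up_weight q c x (1 + int i)"
    define R where "R = q ^ j"
    define V where "V = down_weight q e x (int j)"
    define V' where "V' = down_weight q e x (1 + int j)"
    have recV: "(1 - q * q ^ j) * V' = (1 - x * e * q ^ j) * V"
      unfolding V_def V'_def by (rule down_weight_rec[OF q(1)])
    have recU: "(1 - q * q ^ i) * U' = (x - c * q ^ i) * U"
      unfolding U_def U'_def by (rule up_weight_rec[OF q(1)])
    have n: "nat (int m + 1 + int i) = Suc (m + i)" "nat (int m + int i) = m + i"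
       "nat (int m + int i + 1) = Suc (m + i)"
       "nat (1 + int j) = Suc j"
       "nat (int i + int m) = m + i" "nat (1 + (int i + int m)) = Suc (m + i)" "nat (int i + (1 + int m)) = Suc (m + i)" by simp_all
    define N where "N = gap_weight q (c * e) (Suc (i + j))"
    show ?thesis using recU[folded P_def] recV[folded R_def] unfolding k a
      by (cases s; cases u) (simp_all add: strip_row_factor_eq[OF q] row_factor_def UNIV_bool box_weight_def
          gauge_def n power_add mult_ac add.commute
          del: mult_cancel_left mult_cancel_right flip: M_def P_def R_def N_def U_def U'_def V_def V'_def, algebra+)
  qed
qed

section \<open>Sums over added strips of boxes\<close>

primrec transfer :: "(nat \<Rightarrow> bool \<Rightarrow> bool \<Rightarrow> complex) \<Rightarrow> nat \<Rightarrow> bool \<Rightarrow> complex" where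
  "transfer g 0 t = 1"
| "transfer g (Suc p) t = (\<Sum>s\<in>UNIV. transfer g p s * g p s t)"

text \<open>
  The possible sets of rows, among \<open>0, \<dots>, p\<close>, that receive a box; the flag records whether the last
  row does, which is what has to be remembered when one more row is appended.
\<close>

definition strips :: "nat \<Rightarrow> bool \<Rightarrow> nat set set" where
  "strips p t = {H. H \<subseteq> {..p} \<and> (p \<in> H \<longleftrightarrow> t)}"

lemma finite_strips [simp]: "finite (strips p t)"
  by (rule finite_subset[of _ "Pow {..p}"]) (auto simp: strips_def)

lemma strips_0: "strips 0 t = {if t then {0} else {}}"
  by (auto simp: strips_def)

lemma sum_strips_Suc:
  "(\<Sum>H\<in>strips (Suc p) t. f H)
     = (\<Sum>s\<in>UNIV. \<Sum>H\<in>strips p s. f (if t then insert (Suc p) H else H))" for f :: "nat set \<Rightarrow> complex"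
proof -
  have P: "Pow {..p} = strips p False \<union> strips p True" "strips p False \<inter> strips p True = {}"
    by (auto simp: strips_def)
  have "(\<Sum>H\<in>strips (Suc p) t. f H) = (\<Sum>H\<in>Pow {..p}. f (if t then insert (Suc p) H else H))"
    by (rule sum.reindex_bij_witness[of _ "\<lambda>H. if t then insert (Suc p) H else H" "\<lambda>H. H - {Suc p}"])
      (auto simp: strips_def atMost_Suc insert_absorb split: if_splits)
  also have "\<dots> = (\<Sum>s\<in>UNIV. \<Sum>H\<in>strips p s. f (if t then insert (Suc p) H else H))"
    unfolding P(1) by (subst sum.union_disjoint) (use P(2) in \<open>auto simp: UNIV_bool\<close>)
  finally show ?thesis .
qed

lemma sum_strips_eq_transfer:
  "(\<Sum>H\<in>strips p t. \<Prod>r<p. g r (r \<in> H) (Suc r \<in> H)) = transfer g p t"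
proof (induction p arbitrary: t)
  case 0
  show ?case by (simp add: strips_0)
next
  case (Suc p)
  have "(\<Sum>H\<in>strips p s. \<Prod>r<Suc p. g r (r \<in> (if t then insert (Suc p) H else H)) (Suc r \<in> (if t then insert (Suc p) H else H)))
      = (\<Sum>H\<in>strips p s. (\<Prod>r<p. g r (r \<in> H) (Suc r \<in> H)) * g p s t)" for s
  proof (intro sum.cong refl)
    fix H assume H: "H \<in> strips p s"
    then have "Suc p \<notin> H" "p \<in> H \<longleftrightarrow> s" by (auto simp: strips_def)
    then show "(\<Prod>r<Suc p. g r (r \<in> (if t then insert (Suc p) H else H)) (Suc r \<in> (if t then insert (Suc p) H else H)))
      = (\<Prod>r<p. g r (r \<in> H) (Suc r \<in> H)) * g p s t"
      by (auto intro!: arg_cong2[of _ _ _ _ "(*)"] prod.cong)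
  qed
  then show ?case by (simp add: sum_strips_Suc Suc.IH flip: sum_distrib_right)
qed

lemma gauge_trivial: "gauge q z x 0 True t m = 1" by (simp add: gauge_def)

lemma box_weight_trivial: "box_weight q z c 0 True t m = 1" by (simp add: box_weight_def)

text \<open>
  Moving the gauge matrix through the rows \<open>0, \<dots>, r\<close>.  The start of the induction is itself an
  instance of \<open>local_exchange\<close>: an imaginary row above the first one with \<open>d = 0\<close> has trivial
  weights.  Where \<open>nat\<close> truncates a negative exponent, the accompanying branching factor is 0.
\<close>

lemma transfer_exchange:
  assumes "norm q < 1" "\<And>s. s \<le> r \<Longrightarrow> norm (c s * d s) < 1" "\<And>s. s \<le> r \<Longrightarrow> l (Suc s) \<le> l s"
  shows "transfer (\<lambda>r s t. strip_row_factor q z x (c r) (d r) s t (l r) (l (Suc r)) (k r)) (Suc r) u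
    = (\<Sum>s\<in>UNIV. transfer (\<lambda>r s t. row_factor q x (c r) (d r) s (l r) (l (Suc r)) (k r)
           * box_weight q z (c (Suc r)) (d r) s t (nat (int (k r) - of_bool s - (int (k (Suc r)) - of_bool t)))) r s
        * row_factor q x (c r) (d r) s (l r) (l (Suc r)) (k r)
        * gauge q z x (d r) s u (nat (int (k r) - of_bool s - int (l (Suc r)))))"
  using assms
proof (induction r arbitrary: u)
  case 0
  show ?case
    using local_exchange[of q "c 0" "d 0" "l (Suc 0)" "l 0" z x 0 True 0 u "k 0"] 0
    by (simp add: gauge_trivial box_weight_trivial)
next
  case (Suc r)
  define Y where "Y = transfer (\<lambda>r s t. row_factor q x (c r) (d r) s (l r) (l (Suc r)) (k r)
           * box_weight q z (c (Suc r)) (d r) s t (nat (int (k r) - of_bool s - (int (k (Suc r)) - of_bool t))))"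
  define S where "S r s = row_factor q x (c r) (d r) s (l r) (l (Suc r)) (k r)" for r s
  define L where "L t = strip_row_factor q z x (c (Suc r)) (d (Suc r)) t u (l (Suc r)) (l (Suc (Suc r))) (k (Suc r))" for t
  define m where "m r s = nat (int (k r) - of_bool s - int (l (Suc r)))" for r s
  define W where "W s t = box_weight q z (c (Suc r)) (d r) s t (nat (int (k r) - of_bool s - (int (k (Suc r)) - of_bool t)))" for s t
  have *: "S r s * (\<Sum>t\<in>UNIV. gauge q z x (d r) s t (m r s) * L t)
      = S r s * (\<Sum>t\<in>UNIV. W s t * S (Suc r) t * gauge q z x (d (Suc r)) t u (m (Suc r) t))" for s
  proof (cases "int (k r) - of_bool s - int (l (Suc r)) < 0")
    case True
    then show ?thesis by (simp add: S_def row_factor_def)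
  next
    case False
    then have "int (m r s) = int (k r) - of_bool s - int (l (Suc r))" by (simp add: m_def)
    then have e: "int (m r s) + (int (l (Suc r)) - int (k (Suc r))) + of_bool t = int (k r) - of_bool s - (int (k (Suc r)) - of_bool t)" for t
      by simp
    have "(\<Sum>t\<in>UNIV. gauge q z x (d r) s t (m r s) * L t)
      = (\<Sum>t\<in>UNIV. W s t * S (Suc r) t * gauge q z x (d (Suc r)) t u (m (Suc r) t))"
      unfolding L_def S_def W_def m_def[of "Suc r"] e[symmetric]
      by (rule local_exchange) (use Suc.prems in auto)
    then show ?thesis by simp
  qed
  have IH: "transfer (\<lambda>r s t. strip_row_factor q z x (c r) (d r) s t (l r) (l (Suc r)) (k r)) (Suc r) t
     = (\<Sum>s\<in>UNIV. Y r s * S r s * gauge q z x (d r) s t (m r s))" for t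
    using Suc.IH[of t] Suc.prems by (simp add: Y_def S_def m_def)
  have "transfer (\<lambda>r s t. strip_row_factor q z x (c r) (d r) s t (l r) (l (Suc r)) (k r)) (Suc (Suc r)) u
     = (\<Sum>t\<in>UNIV. (\<Sum>s\<in>UNIV. Y r s * S r s * gauge q z x (d r) s t (m r s)) * L t)"
    by (subst transfer.simps) (simp only: IH L_def)
  also have "\<dots> = (\<Sum>s\<in>UNIV. Y r s * (S r s * (\<Sum>t\<in>UNIV. gauge q z x (d r) s t (m r s) * L t)))"
    by (simp add: sum_distrib_left sum_distrib_right UNIV_bool algebra_simps)
  also have "\<dots> = (\<Sum>t\<in>UNIV. (\<Sum>s\<in>UNIV. Y r s * (S r s * W s t)) * S (Suc r) t * gauge q z x (d (Suc r)) t u (m (Suc r) t))"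
    unfolding * by (simp add: sum_distrib_left sum_distrib_right UNIV_bool algebra_simps)
  also have "\<dots> = (\<Sum>t\<in>UNIV. Y (Suc r) t * S (Suc r) t * gauge q z x (d (Suc r)) t u (m (Suc r) t))"
    unfolding Y_def by (simp only: transfer.simps S_def W_def mult.assoc)
  finally show ?case by (simp add: Y_def S_def m_def)
qed

definition add_boxes :: "(nat \<Rightarrow> nat) \<Rightarrow> nat set \<Rightarrow> nat \<Rightarrow> nat" where
  "add_boxes l H i = l i + of_bool (i \<in> H)"

text \<open>
  The two monodromy entries of the introduction: \<open>t = True\<close> is \<open>C(z; \<lambda>)\<close> and
  \<open>t = False\<close> is \<open>B(z; \<lambda>)\<close>, for \<open>p + 1\<close> variables.
\<close>

definition strip_sum :: "complex \<Rightarrow> complex \<Rightarrow> nat \<Rightarrow> bool \<Rightarrow> (nat \<Rightarrow> nat) \<Rightarrow>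
    (nat \<Rightarrow> complex) \<Rightarrow> (nat \<Rightarrow> complex) \<Rightarrow> (nat \<Rightarrow> complex) \<Rightarrow> complex" where
  "strip_sum q z p t l x c d = (\<Sum>H\<in>strips p t.
     (\<Prod>r<p. box_weight q z (c r) (d r) (r \<in> H) (Suc r \<in> H) (l r - l (Suc r)))
       * spin_whittaker q (Suc p) (add_boxes l H) x c d)"

section \<open>The branching rule as a sum over bounded tuples\<close>

text \<open>
  Summing over all bounded tuples instead of interlacing partitions makes translation by a set of
  boxes a bijection up to terms that vanish.
\<close>

definition bounded_tuples :: "nat \<Rightarrow> nat \<Rightarrow> (nat \<Rightarrow> nat) set" where
  "bounded_tuples p B = {k. (\<forall>i<p. k i \<le> B) \<and> (\<forall>i\<ge>p. k i = 0)}"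

lemma finite_bounded_tuples [simp]: "finite (bounded_tuples p B)"
proof -
  have "bounded_tuples p B = {k. \<forall>i. (i \<in> {..<p} \<longrightarrow> k i \<in> {..B}) \<and> (i \<notin> {..<p} \<longrightarrow> k i = 0)}"
    unfolding bounded_tuples_def lessThan_iff atMost_iff not_less by blast
  moreover have "finite {k. \<forall>i. (i \<in> {..<p} \<longrightarrow> k i \<in> {..B}) \<and> (i \<notin> {..<p} \<longrightarrow> k i = 0)}"
    by (rule finite_set_of_finite_funs) auto
  ultimately show ?thesis by simp
qed

definition row_weight :: "complex \<Rightarrow> nat \<Rightarrow> complex \<Rightarrow> (nat \<Rightarrow> complex) \<Rightarrow> (nat \<Rightarrow> complex) \<Rightarrow>
    (nat \<Rightarrow> nat) \<Rightarrow> (nat \<Rightarrow> nat) \<Rightarrow> complex" where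
  "row_weight q p y c d l k = y ^ l p * (\<Prod>r<p. row_factor q y (c r) (d r) False (l r) (l (Suc r)) (k r))"

lemma row_weight_eq_0:
  assumes "r < p" "l r < k r \<or> k r < l (Suc r)"
  shows "row_weight q p y c d l k = 0"
proof -
  have "row_factor q y (c r) (d r) False (l r) (l (Suc r)) (k r) = 0" using assms(2) by (auto simp: row_factor_def)
  then show ?thesis using assms(1) by (auto simp: row_weight_def)
qed

text \<open>
  Since \<open>c p = 0\<close>, the factor of the last row collapses to a power of the variable.
\<close>

lemma spin_skew_eq_row_weight:
  assumes "c p = 0" "\<And>i. i > p \<Longrightarrow> l i = 0" "\<And>i. i \<ge> p \<Longrightarrow> k i = 0"
    and "norm q < 1"
  shows "spin_skew q (Suc p) l k y c d = row_weight q p y c d l k"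
proof (cases "interlaces k l")
  case True
  then have i: "k i \<le> l i" "l (Suc i) \<le> k i" for i by (auto simp: interlaces_def)
  have "spin_skew q (Suc p) l k y c d
     = (\<Prod>r<p. (\<Prod>i<l r - k r. y - c r * q ^ i) * qpoch (y * d r) q (k r - l (Suc r))
                  * qpoch q q (l r - l (Suc r))
                / (qpoch q q (l r - k r) * qpoch q q (k r - l (Suc r))
                  * qpoch (c r * d r) q (l r - l (Suc r)))) * (y ^ l p * qpoch q q (l p) / qpoch q q (l p))"
    using True assms(1) assms(2)[of "Suc p"] assms(3)[of p]
    by (simp add: spin_skew_def qpoch_def[of 0])
  also have "qpoch q q (l p) \<noteq> 0" using assms(4) by (simp add: qpoch_nonzero)
  then have "y ^ l p * qpoch q q (l p) / qpoch q q (l p) = y ^ l p" by simp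
  also have "(\<Prod>r<p. (\<Prod>i<l r - k r. y - c r * q ^ i) * qpoch (y * d r) q (k r - l (Suc r))
                  * qpoch q q (l r - l (Suc r))
                / (qpoch q q (l r - k r) * qpoch q q (k r - l (Suc r))
                  * qpoch (c r * d r) q (l r - l (Suc r))))
     = (\<Prod>r<p. row_factor q y (c r) (d r) False (l r) (l (Suc r)) (k r))"
  proof (rule prod.cong)
    fix r
    have "nat (int (l r) - int (k r)) = l r - k r" "nat (int (k r) - int (l (Suc r))) = k r - l (Suc r)"
      using i[of r] by simp_all
    then show "(\<Prod>i<l r - k r. y - c r * q ^ i) * qpoch (y * d r) q (k r - l (Suc r))
                  * qpoch q q (l r - l (Suc r))
                / (qpoch q q (l r - k r) * qpoch q q (k r - l (Suc r))
                  * qpoch (c r * d r) q (l r - l (Suc r)))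
       = row_factor q y (c r) (d r) False (l r) (l (Suc r)) (k r)"
      using i[of r] by (simp add: row_factor_def gap_weight_def up_weight_def down_weight_def mult_ac)
  qed simp
  finally show ?thesis by (simp add: row_weight_def mult_ac)
next
  case False
  then obtain i where i: "l i < k i \<or> k i < l (Suc i)" by (auto simp: interlaces_def not_le)
  then have "i < p" using assms(2)[of "Suc i"] assms(2)[of i] assms(3)[of i] by (cases "i < p") auto
  then show ?thesis using False row_weight_eq_0[of i p l k] i by (simp add: spin_skew_def)
qed

lemma sum_skew_eq_sum_bounded_tuples:
  assumes "c p = 0" "\<And>i. i > p \<Longrightarrow> l i = 0" "\<And>i. i < p \<Longrightarrow> l i \<le> B" "norm q < 1"
  shows "(\<Sum>k\<in>{k \<in> partitions p. interlaces k l}. f k * spin_skew q (Suc p) l k y c d)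
     = (\<Sum>k\<in>bounded_tuples p B. f k * row_weight q p y c d l k)"
proof (rule sum.mono_neutral_cong_left)
  show "{k \<in> partitions p. interlaces k l} \<subseteq> bounded_tuples p B"
  proof
    fix k assume k: "k \<in> {k \<in> partitions p. interlaces k l}"
    then have "k i \<le> B" if "i < p" for i
      using assms(3)[OF that] by (auto simp: interlaces_def intro: le_trans[of "k i" "l i"])
    then show "k \<in> bounded_tuples p B" using k by (simp add: partitions_def bounded_tuples_def)
  qed
  show "\<forall>k\<in>bounded_tuples p B - {k \<in> partitions p. interlaces k l}. f k * row_weight q p y c d l k = 0"
  proof
    fix k assume k: "k \<in> bounded_tuples p B - {k \<in> partitions p. interlaces k l}"
    have "\<not> interlaces k l"
    proof
      assume "interlaces k l"
      moreover from this have "k (Suc i) \<le> k i" for i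
        by (meson interlaces_def order_trans)
      ultimately show False using k by (auto simp: partitions_def bounded_tuples_def)
    qed
    then obtain i where i: "l i < k i \<or> k i < l (Suc i)" by (auto simp: interlaces_def not_le)
    then have "i < p" using assms(2)[of "Suc i"] k
      by (cases "i < p") (auto simp: bounded_tuples_def)
    then show "f k * row_weight q p y c d l k = 0" using row_weight_eq_0[of i p l k] i by simp
  qed
next
  fix k assume "k \<in> {k \<in> partitions p. interlaces k l}"
  then show "f k * spin_skew q (Suc p) l k y c d = f k * row_weight q p y c d l k"
    using assms by (subst spin_skew_eq_row_weight) (auto simp: partitions_def)
qed simp

lemma sum_bounded_tuples_shift:
  fixes T f :: "(nat \<Rightarrow> nat) \<Rightarrow> complex"
  assumes H: "H \<subseteq> {..<p}" and T: "\<And>k i. i < p \<Longrightarrow> k i > B \<Longrightarrow> T k = 0"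
  shows "(\<Sum>k\<in>bounded_tuples p B. T k * f (add_boxes k H))
       = (\<Sum>k\<in>bounded_tuples p (Suc B). (if \<forall>i\<in>H. k i \<noteq> 0 then T (\<lambda>i. k i - of_bool (i \<in> H)) else 0) * f k)"
proof -
  let ?R = "\<lambda>k i. k i - of_bool (i \<in> H)"
  let ?S = "{k \<in> bounded_tuples p (Suc B). (\<forall>i\<in>H. k i \<noteq> 0) \<and> ?R k \<in> bounded_tuples p B}"
  have add: "add_boxes (?R k) H = k" if "\<forall>i\<in>H. k i \<noteq> 0" for k
    using that by (auto simp: add_boxes_def fun_eq_iff)
  have rem: "?R (add_boxes k H) = k" for k by (simp add: add_boxes_def)
  have mem: "add_boxes k H \<in> bounded_tuples p (Suc B)" if "k \<in> bounded_tuples p B" for k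
    using that H by (auto simp: add_boxes_def bounded_tuples_def of_bool_def le_Suc_eq)
  have "(\<Sum>k\<in>bounded_tuples p B. T k * f (add_boxes k H)) = (\<Sum>k\<in>?S. T (?R k) * f k)"
  proof (rule sum.reindex_bij_witness[of _ ?R "\<lambda>k. add_boxes k H"])
    fix k assume "k \<in> bounded_tuples p B"
    then show "add_boxes k H \<in> ?S" unfolding mem_Collect_eq rem using mem by (simp add: add_boxes_def)
  next
    fix k assume k: "k \<in> ?S"
    then show "add_boxes (?R k) H = k" by (intro add) simp
    from k show "?R k \<in> bounded_tuples p B" by simp
  qed (simp_all only: rem)
  also have "\<dots> = (\<Sum>k\<in>bounded_tuples p (Suc B). (if \<forall>i\<in>H. k i \<noteq> 0 then T (?R k) else 0) * f k)"
  proof (rule sum.mono_neutral_cong_left)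
    show "\<forall>k\<in>bounded_tuples p (Suc B) - ?S. (if \<forall>i\<in>H. k i \<noteq> 0 then T (?R k) else 0) * f k = 0"
    proof
      fix k assume k: "k \<in> bounded_tuples p (Suc B) - ?S"
      show "(if \<forall>i\<in>H. k i \<noteq> 0 then T (?R k) else 0) * f k = 0"
      proof (cases "\<forall>i\<in>H. k i \<noteq> 0")
        case True
        then have "?R k \<notin> bounded_tuples p B" using k by blast
        moreover have "?R k i = 0" if "i \<ge> p" for i using that k by (simp add: bounded_tuples_def)
        ultimately obtain i where "i < p" "?R k i > B" unfolding bounded_tuples_def using not_le by blast
        then have "T (?R k) = 0" by (rule T)
        then show ?thesis by simp
      next
        case False
        then show ?thesis by (simp only: if_False mult_zero_left)
      qed
    qed
  qed auto
  finally show ?thesis .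
qed

lemma spin_whittaker_Suc_bounded_tuples:
  assumes "norm q < 1" "c p = 0" "\<And>i. i > p \<Longrightarrow> l i = 0" "\<And>i. i < p \<Longrightarrow> l i \<le> B"
  shows "spin_whittaker q (Suc p) l x c d
     = (\<Sum>k\<in>bounded_tuples p B. spin_whittaker q p k x (\<lambda>i. c (Suc i)) d * row_weight q p (x p) c d l k)"
  using sum_skew_eq_sum_bounded_tuples[where c = c and p = p and l = l and B = B] assms by simp

lemma partitions_mono: "l \<in> partitions n \<Longrightarrow> i \<le> j \<Longrightarrow> l j \<le> l i"
  by (rule lift_Suc_antimono_le[of l]) (auto simp: partitions_def)

lemma norm_mult_less_1: "norm a < 1 \<Longrightarrow> norm b < 1 \<Longrightarrow> norm (a * b :: complex) < 1"
  by (metis norm_mult norm_ge_zero mult_strict_mono mult_1 zero_less_one)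

section \<open>The recursion of the monodromy entries\<close>

lemma strip_sum_eq_transfer:
  assumes "norm q < 1" "c p = 0" "l \<in> partitions (Suc p)"
  shows "strip_sum q z p t l x c d
     = (\<Sum>k\<in>bounded_tuples p (Suc (l 0)). spin_whittaker q p k x (\<lambda>i. c (Suc i)) d
          * (x p ^ (l p + of_bool t)
             * transfer (\<lambda>r s t. strip_row_factor q z (x p) (c r) (d r) s t (l r) (l (Suc r)) (k r)) p t))"
proof -
  let ?f = "\<lambda>k. spin_whittaker q p k x (\<lambda>i. c (Suc i)) d"
  have "strip_sum q z p t l x c d = (\<Sum>H\<in>strips p t. \<Sum>k\<in>bounded_tuples p (Suc (l 0)). ?f k * (x p ^ (l p + of_bool t)
        * (\<Prod>r<p. strip_row_factor q z (x p) (c r) (d r) (r \<in> H) (Suc r \<in> H) (l r) (l (Suc r)) (k r))))"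
    unfolding strip_sum_def
  proof (rule sum.cong)
    fix H assume H: "H \<in> strips p t"
    then have Hp: "H \<subseteq> {..p}" "p \<in> H \<longleftrightarrow> t" by (auto simp: strips_def)
    \<comment> \<open>The bound must leave room for one added box in the first row.\<close>
    have "spin_whittaker q (Suc p) (add_boxes l H) x c d
       = (\<Sum>k\<in>bounded_tuples p (Suc (l 0)). ?f k * row_weight q p (x p) c d (add_boxes l H) k)"
    proof (rule spin_whittaker_Suc_bounded_tuples)
      show "add_boxes l H i = 0" if "i > p" for i
        using that Hp(1) assms(3) by (auto simp: add_boxes_def partitions_def)
      show "add_boxes l H i \<le> Suc (l 0)" for i
        using partitions_mono[OF assms(3), of 0 i] by (simp add: add_boxes_def of_bool_def)
    qed (use assms in auto)
    moreover have "(\<Prod>r<p. box_weight q z (c r) (d r) (r \<in> H) (Suc r \<in> H) (l r - l (Suc r)))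
        * row_weight q p (x p) c d (add_boxes l H) k
      = x p ^ (l p + of_bool t)
        * (\<Prod>r<p. strip_row_factor q z (x p) (c r) (d r) (r \<in> H) (Suc r \<in> H) (l r) (l (Suc r)) (k r))" for k
    proof -
      have "x p ^ (l p + of_bool t) = x p ^ add_boxes l H p" by (simp add: add_boxes_def Hp)
      moreover have "strip_row_factor q z (x p) (c r) (d r) (r \<in> H) (Suc r \<in> H) (l r) (l (Suc r)) (k r)
        = box_weight q z (c r) (d r) (r \<in> H) (Suc r \<in> H) (l r - l (Suc r))
          * row_factor q (x p) (c r) (d r) False (add_boxes l H r) (add_boxes l H (Suc r)) (k r)" for r
        by (simp add: strip_row_factor_def row_factor_def add_boxes_def algebra_simps)
      ultimately show ?thesis by (simp add: row_weight_def prod.distrib mult_ac)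
    qed
    ultimately show "(\<Prod>r<p. box_weight q z (c r) (d r) (r \<in> H) (Suc r \<in> H) (l r - l (Suc r)))
        * spin_whittaker q (Suc p) (add_boxes l H) x c d
      = (\<Sum>k\<in>bounded_tuples p (Suc (l 0)). ?f k * (x p ^ (l p + of_bool t)
        * (\<Prod>r<p. strip_row_factor q z (x p) (c r) (d r) (r \<in> H) (Suc r \<in> H) (l r) (l (Suc r)) (k r))))"
      by (simp add: sum_distrib_left mult.left_commute)
  qed simp
  also have "\<dots> = (\<Sum>k\<in>bounded_tuples p (Suc (l 0)). \<Sum>H\<in>strips p t. ?f k * (x p ^ (l p + of_bool t)
        * (\<Prod>r<p. strip_row_factor q z (x p) (c r) (d r) (r \<in> H) (Suc r \<in> H) (l r) (l (Suc r)) (k r))))"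
    by (rule sum.swap)
  also have "\<dots> = (\<Sum>k\<in>bounded_tuples p (Suc (l 0)). ?f k * (x p ^ (l p + of_bool t)
        * transfer (\<lambda>r s t. strip_row_factor q z (x p) (c r) (d r) s t (l r) (l (Suc r)) (k r)) p t))"
    by (subst sum_strips_eq_transfer[symmetric]) (simp add: sum_distrib_left)
  finally show ?thesis .
qed

text \<open>
  If a box is to be removed from an empty row, the right-hand side is 0 because it contains a
  value of \<open>down_weight\<close> at a negative integer.
\<close>

lemma row_factors_remove_boxes:
  "(if \<forall>r\<in>H \<inter> {..<p}. k r \<noteq> 0 then \<Prod>r<p. row_factor q y (c r) (d r) False (l r) (l (Suc r)) (k r - of_bool (r \<in> H)) else 0)
    = (\<Prod>r<p. row_factor q y (c r) (d r) (r \<in> H) (l r) (l (Suc r)) (k r))"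
proof (cases "\<forall>r\<in>H \<inter> {..<p}. k r \<noteq> 0")
  case True
  have "row_factor q y (c r) (d r) False (l r) (l (Suc r)) (k r - of_bool (r \<in> H))
     = row_factor q y (c r) (d r) (r \<in> H) (l r) (l (Suc r)) (k r)" if "r < p" for r
  proof (cases "r \<in> H")
    case H: True
    with True that obtain j where "k r = Suc j" by (metis IntI lessThan_iff not0_implies_Suc)
    with H show ?thesis by (simp add: row_factor_def algebra_simps)
  qed (simp add: row_factor_def)
  then show ?thesis using True by simp
next
  case False
  then obtain r where "r \<in> H" "r < p" "k r = 0" by auto
  then have "row_factor q y (c r) (d r) (r \<in> H) (l r) (l (Suc r)) (k r) = 0" by (simp add: row_factor_def)
  then have "(\<Prod>r<p. row_factor q y (c r) (d r) (r \<in> H) (l r) (l (Suc r)) (k r)) = 0"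
    using \<open>r < p\<close> by (auto intro: prod_zero)
  then show ?thesis unfolding if_not_P[OF False] by (rule sym)
qed

text \<open>
  The coefficient of a fixed polynomial \<open>F\<^sub>\<kappa>\<close> when first branching from \<open>\<lambda>\<close> to \<open>\<mu>\<close> and then adding
  boxes to \<open>\<mu>\<close>.  The function \<open>\<phi>\<close> leaves room for the gauge entry, which depends on the last row
  of \<open>\<mu>\<close>.
\<close>

lemma row_weight_strip_sum_eq_transfer:
  fixes \<phi> :: "nat \<Rightarrow> complex"
  assumes l: "l \<in> partitions (Suc (Suc p))"
  shows "(\<Sum>m\<in>bounded_tuples (Suc p) (l 0). row_weight q (Suc p) y c d l m * (\<phi> (m p) * strip_sum q z p s m x (\<lambda>i. c (Suc i)) d))
    = (\<Sum>k\<in>bounded_tuples (Suc p) (Suc (l 0)). spin_whittaker q (Suc p) k x (\<lambda>i. c (Suc i)) d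
        * (y ^ l (Suc p) * (transfer (\<lambda>r s t. row_factor q y (c r) (d r) s (l r) (l (Suc r)) (k r)
           * box_weight q z (c (Suc r)) (d r) s t (nat (int (k r) - of_bool s - (int (k (Suc r)) - of_bool t)))) p s
        * row_factor q y (c p) (d p) s (l p) (l (Suc p)) (k p) * \<phi> (k p - of_bool s))))"
    (is "?L = (\<Sum>k\<in>?box. ?f k * (y ^ _ * (transfer (?Y k) p s * ?S k p s * _)))")
proof -
  let ?W = "\<lambda>H m. \<Prod>r<p. box_weight q z (c (Suc r)) (d r) (r \<in> H) (Suc r \<in> H) (m r - m (Suc r))"
  have "?L = (\<Sum>m\<in>bounded_tuples (Suc p) (l 0). \<Sum>H\<in>strips p s. (row_weight q (Suc p) y c d l m * (\<phi> (m p) * ?W H m)) * ?f (add_boxes m H))"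
    by (simp add: strip_sum_def sum_distrib_left mult_ac)
  also have "\<dots> = (\<Sum>H\<in>strips p s. \<Sum>m\<in>bounded_tuples (Suc p) (l 0). (row_weight q (Suc p) y c d l m * (\<phi> (m p) * ?W H m)) * ?f (add_boxes m H))"
    by (rule sum.swap)
  also have "\<dots> = (\<Sum>H\<in>strips p s. \<Sum>k\<in>?box. ?f k * (y ^ l (Suc p) * ((\<Prod>r<p. ?Y k r (r \<in> H) (Suc r \<in> H)) * ?S k p s * \<phi> (k p - of_bool s))))"
  proof (rule sum.cong)
    fix H assume "H \<in> strips p s"
    then have H: "H \<subseteq> {..<Suc p}" "p \<in> H \<longleftrightarrow> s" by (auto simp: strips_def)
    let ?R = "\<lambda>k i. k i - of_bool (i \<in> H)"
    have "(\<Sum>m\<in>bounded_tuples (Suc p) (l 0). (row_weight q (Suc p) y c d l m * (\<phi> (m p) * ?W H m)) * ?f (add_boxes m H))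
       = (\<Sum>k\<in>?box. (if \<forall>i\<in>H. k i \<noteq> 0 then row_weight q (Suc p) y c d l (?R k) * (\<phi> (?R k p) * ?W H (?R k)) else 0) * ?f k)"
    proof (rule sum_bounded_tuples_shift[OF H(1)])
      fix k i assume "i < Suc p" "k i > l 0"
      then show "row_weight q (Suc p) y c d l k * (\<phi> (k p) * ?W H k) = 0"
        using row_weight_eq_0[of i "Suc p" l k] partitions_mono[OF l, of 0 i] by simp
    qed
    also have "\<dots> = (\<Sum>k\<in>?box. ?f k * (y ^ l (Suc p) * ((\<Prod>r<p. ?Y k r (r \<in> H) (Suc r \<in> H)) * ?S k p s * \<phi> (k p - of_bool s))))"
    proof (rule sum.cong)
      fix k
      have HI: "H \<inter> {..<Suc p} = H" using H(1) by blast
      have row: "(\<Prod>r<Suc p. ?S k r (r \<in> H)) = (if \<forall>i\<in>H. k i \<noteq> 0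
         then \<Prod>r<Suc p. row_factor q y (c r) (d r) False (l r) (l (Suc r)) (?R k r) else 0)"
        by (subst row_factors_remove_boxes[symmetric]) (simp only: HI)
      have split: "(\<Prod>r<p. ?Y k r (r \<in> H) (Suc r \<in> H)) * ?S k p s
        = (\<Prod>r<Suc p. ?S k r (r \<in> H))
          * (\<Prod>r<p. box_weight q z (c (Suc r)) (d r) (r \<in> H) (Suc r \<in> H) (nat (int (k r) - of_bool (r \<in> H) - (int (k (Suc r)) - of_bool (Suc r \<in> H)))))"
        by (simp add: prod.distrib H(2) mult_ac)
      show "(if \<forall>i\<in>H. k i \<noteq> 0 then row_weight q (Suc p) y c d l (?R k) * (\<phi> (?R k p) * ?W H (?R k)) else 0) * ?f k
         = ?f k * (y ^ l (Suc p) * ((\<Prod>r<p. ?Y k r (r \<in> H) (Suc r \<in> H)) * ?S k p s * \<phi> (k p - of_bool s)))"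
      proof (cases "\<forall>i\<in>H. k i \<noteq> 0")
        case True
        have "nat (int (k r) - of_bool (r \<in> H) - (int (k (Suc r)) - of_bool (Suc r \<in> H))) = ?R k r - ?R k (Suc r)" for r
          using True by (auto simp: of_bool_def Suc_le_eq nat_diff_distrib' split: if_splits)
        then show ?thesis unfolding split row if_P[OF True] by (simp only: row_weight_def H(2) mult_ac)
      next
        case False
        show ?thesis unfolding split row if_not_P[OF False] by simp
      qed
    qed simp
    finally show "(\<Sum>m\<in>bounded_tuples (Suc p) (l 0). (row_weight q (Suc p) y c d l m * (\<phi> (m p) * ?W H m)) * ?f (add_boxes m H))
      = (\<Sum>k\<in>?box. ?f k * (y ^ l (Suc p) * ((\<Prod>r<p. ?Y k r (r \<in> H) (Suc r \<in> H)) * ?S k p s * \<phi> (k p - of_bool s))))" .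
  qed simp
  also have "\<dots> = (\<Sum>k\<in>?box. \<Sum>H\<in>strips p s. ?f k * (y ^ l (Suc p) * ((\<Prod>r<p. ?Y k r (r \<in> H) (Suc r \<in> H)) * ?S k p s * \<phi> (k p - of_bool s))))"
    by (rule sum.swap)
  also have "\<dots> = (\<Sum>k\<in>?box. ?f k * (y ^ l (Suc p) * (transfer (?Y k) p s * ?S k p s * \<phi> (k p - of_bool s))))"
    by (subst sum_strips_eq_transfer[symmetric]) (simp add: sum_distrib_left sum_distrib_right)
  finally show ?thesis .
qed

text \<open>
  Expanding in the \<open>F\<^sub>\<kappa>\<close>, the left-hand side is described by \<open>strip_sum_eq_transfer\<close> and the
  right-hand side by \<open>row_weight_strip_sum_eq_transfer\<close>; the coefficients agree by \<open>transfer_exchange\<close>.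
\<close>

theorem strip_sum_Suc:
  assumes q: "norm q < 1" and c: "c (Suc p) = 0" and l: "l \<in> partitions (Suc (Suc p))"
    and cd: "\<And>r. r \<le> p \<Longrightarrow> norm (c r) < 1" "\<And>r. r \<le> p \<Longrightarrow> norm (d r) < 1"
  shows "strip_sum q z (Suc p) t l x c d = x (Suc p) ^ of_bool t
     * (\<Sum>m\<in>{m \<in> partitions (Suc p). interlaces m l}.
         (\<Sum>s\<in>UNIV. gauge q z (x (Suc p)) (d p) s t (m p - l (Suc p)) * strip_sum q z p s m x (\<lambda>i. c (Suc i)) d)
           * spin_skew q (Suc (Suc p)) l m (x (Suc p)) c d)"
proof -
  let ?y = "x (Suc p)" and ?c = "\<lambda>i. c (Suc i)" and ?box = "bounded_tuples (Suc p) (Suc (l 0))"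
  let ?f = "\<lambda>k. spin_whittaker q (Suc p) k x ?c d"
  let ?Z = "\<lambda>k s. transfer (\<lambda>r s t. row_factor q ?y (c r) (d r) s (l r) (l (Suc r)) (k r)
           * box_weight q z (c (Suc r)) (d r) s t (nat (int (k r) - of_bool s - (int (k (Suc r)) - of_bool t)))) p s
        * row_factor q ?y (c p) (d p) s (l p) (l (Suc p)) (k p)"
  let ?g = "\<lambda>s m. gauge q z ?y (d p) s t (m - l (Suc p))"
  have decr: "l (Suc r) \<le> l r" for r using partitions_mono[OF l] by simp
  have "strip_sum q z (Suc p) t l x c d = (\<Sum>k\<in>?box. ?f k * (?y ^ (l (Suc p) + of_bool t)
             * transfer (\<lambda>r s t. strip_row_factor q z ?y (c r) (d r) s t (l r) (l (Suc r)) (k r)) (Suc p) t))"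
    by (rule strip_sum_eq_transfer) (use q c l in auto)
  also have "\<dots> = (\<Sum>k\<in>?box. ?f k * (?y ^ (l (Suc p) + of_bool t) * (\<Sum>s\<in>UNIV. ?Z k s * ?g s (k p - of_bool s))))"
  proof (rule sum.cong)
    fix k
    have "transfer (\<lambda>r s t. strip_row_factor q z ?y (c r) (d r) s t (l r) (l (Suc r)) (k r)) (Suc p) t
       = (\<Sum>s\<in>UNIV. ?Z k s * gauge q z ?y (d p) s t (nat (int (k p) - of_bool s - int (l (Suc p)))))"
      by (rule transfer_exchange) (use q cd decr norm_mult_less_1 in auto)
    also have "\<dots> = (\<Sum>s\<in>UNIV. ?Z k s * ?g s (k p - of_bool s))"
    proof (rule sum.cong)
      fix s
      have "nat (int (k p) - of_bool s - int (l (Suc p))) = k p - of_bool s - l (Suc p)"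
        by (auto simp: of_bool_def)
      then show "?Z k s * gauge q z ?y (d p) s t (nat (int (k p) - of_bool s - int (l (Suc p)))) = ?Z k s * ?g s (k p - of_bool s)"
        by (simp only:)
    qed simp
    finally show "?f k * (?y ^ (l (Suc p) + of_bool t) * transfer (\<lambda>r s t. strip_row_factor q z ?y (c r) (d r) s t (l r) (l (Suc r)) (k r)) (Suc p) t)
      = ?f k * (?y ^ (l (Suc p) + of_bool t) * (\<Sum>s\<in>UNIV. ?Z k s * ?g s (k p - of_bool s)))" by (simp only:)
  qed simp
  also have "\<dots> = ?y ^ of_bool t * (\<Sum>s\<in>UNIV. \<Sum>k\<in>?box. ?f k * (?y ^ l (Suc p) * (?Z k s * ?g s (k p - of_bool s))))"
    by (subst sum.swap) (simp add: sum_distrib_left power_add mult_ac)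
  also have "\<dots> = ?y ^ of_bool t * (\<Sum>s\<in>UNIV. \<Sum>m\<in>bounded_tuples (Suc p) (l 0). row_weight q (Suc p) ?y c d l m * (?g s (m p) * strip_sum q z p s m x ?c d))"
    by (subst row_weight_strip_sum_eq_transfer[OF l]) simp
  also have "\<dots> = ?y ^ of_bool t * (\<Sum>m\<in>bounded_tuples (Suc p) (l 0). (\<Sum>s\<in>UNIV. ?g s (m p) * strip_sum q z p s m x ?c d) * row_weight q (Suc p) ?y c d l m)"
    by (subst sum.swap) (simp add: sum_distrib_left mult_ac)
  also have "(\<Sum>m\<in>bounded_tuples (Suc p) (l 0). (\<Sum>s\<in>UNIV. ?g s (m p) * strip_sum q z p s m x ?c d) * row_weight q (Suc p) ?y c d l m)
     = (\<Sum>m\<in>{m \<in> partitions (Suc p). interlaces m l}. (\<Sum>s\<in>UNIV. ?g s (m p) * strip_sum q z p s m x ?c d) * spin_skew q (Suc (Suc p)) l m ?y c d)"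
    by (rule sum_skew_eq_sum_bounded_tuples[symmetric]) (use q c l partitions_mono[OF l] in \<open>auto simp: partitions_def\<close>)
  finally show ?thesis .
qed

lemma bounded_tuples_0 [simp]: "bounded_tuples 0 B = {\<lambda>_. 0}"
  by (auto simp: bounded_tuples_def)

lemma spin_whittaker_1:
  assumes "norm q < 1" "c 0 = 0" "\<And>i. i > 0 \<Longrightarrow> l i = 0"
  shows "spin_whittaker q (Suc 0) l x c d = x 0 ^ l 0"
  by (subst spin_whittaker_Suc_bounded_tuples[where B = 0]) (use assms in \<open>auto simp: row_weight_def\<close>)

section \<open>The Pieri rule\<close>

text \<open>
  The gauge entries combine so that the recursion turns \<open>C - z B\<close> into \<open>x\<^sub>n - z\<close> times the same
  combination one level down, and this factor does not depend on \<open>\<mu>\<close>.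
\<close>

theorem prod_times_spin_whittaker:
  assumes "norm q < 1" "c p = 0" "l \<in> partitions (Suc p)"
    and "\<And>r. r < p \<Longrightarrow> norm (c r) < 1" "\<And>r. r < p \<Longrightarrow> norm (d r) < 1"
  shows "(\<Prod>j\<le>p. x j - z) * spin_whittaker q (Suc p) l x c d
     = strip_sum q z p True l x c d - z * strip_sum q z p False l x c d"
  using assms
proof (induction p arbitrary: l c)
  case 0
  have [simp]: "add_boxes l {} = l" by (simp add: add_boxes_def fun_eq_iff)
  have "\<And>i. i > 0 \<Longrightarrow> l i = 0" using 0 by (auto simp: partitions_def)
  then show ?case by (simp add: strip_sum_def strips_0 spin_whittaker_1 add_boxes_def 0 algebra_simps del: spin_whittaker.simps)
next
  case (Suc p)
  let ?y = "x (Suc p)" and ?c = "\<lambda>i. c (Suc i)"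
  let ?M = "{m \<in> partitions (Suc p). interlaces m l}"
  let ?SS = "\<lambda>m s. strip_sum q z p s m x ?c d"
  let ?K = "\<lambda>m. spin_skew q (Suc (Suc p)) l m ?y c d"
  let ?G = "\<lambda>m s t. gauge q z ?y (d p) s t (m p - l (Suc p))"
  have MR: "strip_sum q z (Suc p) t l x c d = ?y ^ of_bool t * (\<Sum>m\<in>?M. (\<Sum>s\<in>UNIV. ?G m s t * ?SS m s) * ?K m)" for t
    by (rule strip_sum_Suc) (use Suc.prems in auto)
  have *: "?y * (\<Sum>s\<in>UNIV. ?G m s True * ?SS m s) - z * (\<Sum>s\<in>UNIV. ?G m s False * ?SS m s)
     = (?y - z) * (?SS m True - z * ?SS m False)" for m
    by (simp add: UNIV_bool gauge_def algebra_simps)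
  have "strip_sum q z (Suc p) True l x c d - z * strip_sum q z (Suc p) False l x c d
     = (\<Sum>m\<in>?M. (?y * (\<Sum>s\<in>UNIV. ?G m s True * ?SS m s) - z * (\<Sum>s\<in>UNIV. ?G m s False * ?SS m s)) * ?K m)"
  proof -
    define A where "A t m = (\<Sum>s\<in>UNIV. ?G m s t * ?SS m s)" for t m
    show ?thesis unfolding MR A_def[symmetric]
      by (simp add: sum_distrib_left sum_subtractf algebra_simps)
  qed
  also have "\<dots> = (\<Sum>m\<in>?M. (?y - z) * ((\<Prod>j\<le>p. x j - z) * spin_whittaker q (Suc p) m x ?c d) * ?K m)"
  proof (rule sum.cong)
    fix m assume "m \<in> ?M"
    then have "(\<Prod>j\<le>p. x j - z) * spin_whittaker q (Suc p) m x ?c d = ?SS m True - z * ?SS m False"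
      by (intro Suc.IH) (use Suc.prems in auto)
    then show "(?y * (\<Sum>s\<in>UNIV. ?G m s True * ?SS m s) - z * (\<Sum>s\<in>UNIV. ?G m s False * ?SS m s)) * ?K m
      = (?y - z) * ((\<Prod>j\<le>p. x j - z) * spin_whittaker q (Suc p) m x ?c d) * ?K m"
      unfolding * by simp
  qed simp
  also have "\<dots> = (\<Prod>j\<le>Suc p. x j - z) * spin_whittaker q (Suc (Suc p)) l x c d"
    by (subst spin_whittaker.simps(2)) (simp add: sum_distrib_left mult_ac del: spin_whittaker.simps)
  finally show ?case by simp
qed

text \<open>
  At \<open>z = 0\<close> a row with a box below a row without one has weight 0.  Since the last row receives
  a box, all rows do.
\<close>

lemma strip_sum_at_0:
  "strip_sum q 0 p True l x c d = spin_whittaker q (Suc p) (add_boxes l {..p}) x c d"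
proof -
  let ?t = "\<lambda>H. (\<Prod>r<p. box_weight q 0 (c r) (d r) (r \<in> H) (Suc r \<in> H) (l r - l (Suc r)))
       * spin_whittaker q (Suc p) (add_boxes l H) x c d"
  have "strip_sum q 0 p True l x c d = (\<Sum>H\<in>{{..p}}. ?t H)"
    unfolding strip_sum_def
  proof (rule sum.mono_neutral_right)
    show "\<forall>H\<in>strips p True - {{..p}}. ?t H = 0"
    proof
      fix H assume H: "H \<in> strips p True - {{..p}}"
      have "\<exists>r<p. r \<notin> H \<and> Suc r \<in> H"
      proof (rule ccontr)
        assume "\<not> ?thesis"
        then have step: "r \<in> H" if "r < p" "Suc r \<in> H" for r using that by blast
        have "p \<in> H" using H by (simp add: strips_def)
        have "r \<in> H" if "r \<le> p" for r using that
          by (rule inc_induct) (use \<open>p \<in> H\<close> step in auto)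
        then show False using H by (auto simp: strips_def)
      qed
      then obtain r where "r < p" "r \<notin> H" "Suc r \<in> H" by blast
      then have "(\<Prod>r<p. box_weight q 0 (c r) (d r) (r \<in> H) (Suc r \<in> H) (l r - l (Suc r))) = 0"
        by (intro prod_zero bexI[of _ r]) (auto simp: box_weight_def)
      then show "?t H = 0" by simp
    qed
  qed (auto simp: strips_def)
  also have "\<dots> = spin_whittaker q (Suc p) (add_boxes l {..p}) x c d"
    by (simp add: box_weight_def del: spin_whittaker.simps)
  finally show ?thesis .
qed

corollary spin_whittaker_add_column:
  assumes "norm q < 1" "p > 0 \<Longrightarrow> c (p - 1) = 0" "l \<in> partitions p"
    and "\<And>r. r < p - 1 \<Longrightarrow> norm (c r) < 1" "\<And>r. r < p - 1 \<Longrightarrow> norm (d r) < 1"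
  shows "spin_whittaker q p (add_boxes l {..<p}) x c d = (\<Prod>j<p. x j) * spin_whittaker q p l x c d"
proof (cases p)
  case (Suc p')
  then show ?thesis
    using prod_times_spin_whittaker[of q c p' l d x 0] strip_sum_at_0[of q p' l x c d] assms
    by (simp add: lessThan_Suc_atMost del: spin_whittaker.simps)
qed simp

section \<open>The monodromy entry at a variable\<close>

lemma up_weight_shift:
  assumes "norm q < 1"
  shows "up_weight q c (q * x) k = up_weight q c x k - x * up_weight q c x (k - 1)"
proof -
  consider "k < 0" | "k = 0" | i where "k = 1 + int i" 
    by (metis add.commute int_nat_eq linorder_not_less not_less_iff_gr_or_eq of_nat_Suc pos_int_cases zero_less_imp_eq_int zle_iff_zadd nat_int Suc_pred)
  then show ?thesis
  proof cases
    case 3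
    then have n: "nat k = Suc i" "nat (k - 1) = i" by simp_all
    have nz: "qpoch q q (Suc i) \<noteq> 0" "qpoch q q i \<noteq> 0" using assms by (simp_all add: qpoch_nonzero)
    have "(\<Prod>s<Suc i. q * x - c * q ^ s) = (q * x - c) * (\<Prod>s<i. q * (x - c * q ^ s))"
      by (subst prod.lessThan_Suc_shift) (simp add: algebra_simps)
    also have "\<dots> = (q * x - c) * q ^ i * (\<Prod>s<i. x - c * q ^ s)"
      by (simp add: prod.distrib)
    also have "\<dots> = (\<Prod>s<Suc i. x - c * q ^ s) - x * (1 - q * q ^ i) * (\<Prod>s<i. x - c * q ^ s)"
      by (simp add: algebra_simps)
    finally have e: "(\<Prod>s<Suc i. q * x - c * q ^ s) = (\<Prod>s<Suc i. x - c * q ^ s) - x * (1 - q * q ^ i) * (\<Prod>s<i. x - c * q ^ s)" .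
    have "\<not> k < 0" "\<not> k - 1 < 0" using 3 by auto
    then have u: "up_weight q c w k = (\<Prod>s<Suc i. w - c * q ^ s) / qpoch q q (Suc i)"
       "up_weight q c w (k - 1) = (\<Prod>s<i. w - c * q ^ s) / qpoch q q i" for w
      unfolding up_weight_def n by (simp_all only: if_False)
    show ?thesis unfolding u e using nz by (simp add: qpoch_Suc[of q q] field_simps)
  qed simp_all
qed

lemma down_weight_shift:
  assumes "norm q < 1"
  shows "(1 - x * d) * down_weight q d (q * x) (int k) = (1 - x * d * q ^ k) * down_weight q d x (int k)"
proof -
  have "qpoch (x * d) q (Suc k) = (1 - x * d) * qpoch (q * x * d) q k"
    unfolding qpoch_def by (subst prod.lessThan_Suc_shift) (simp add: mult_ac)
  then have "(1 - x * d) * qpoch (q * x * d) q k = (1 - x * d * q ^ k) * qpoch (x * d) q k"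
    by (simp add: qpoch_Suc mult.commute)
  then show ?thesis by (simp add: down_weight_def)
qed

text \<open>
  At \<open>z = x\<close> the sum over \<open>t\<close> is the same for both values of \<open>u\<close>, so the transfer matrix maps the
  constant vector to a constant vector.  Up to
  \<open>1 - x e\<close>, the constant is the branching factor for the variable \<open>q x\<close>.
\<close>

lemma sum_strip_row_factor_diagonal:
  assumes q: "norm q < 1" "norm (c * e) < 1" "b \<le> a"
  shows "(\<Sum>t\<in>UNIV. strip_row_factor q x x c e t u a b k) = (1 - x * e) * row_factor q (q * x) c e True a b k"
proof -
  have "(\<Sum>t\<in>UNIV. strip_row_factor q x x c e t u a b k)
     = (\<Sum>t\<in>UNIV. row_factor q x c e t a b k * gauge q x x e t u (nat (int k - of_bool t - int b)))"
    using local_exchange[OF assms, of x x 0 True 0 u k] by (simp add: gauge_trivial box_weight_trivial)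
  also have "\<dots> = (1 - x * e) * row_factor q (q * x) c e True a b k"
  proof -
    consider "k < b" | "k = b" | j where "k = Suc (b + j)" using less_iff_Suc_add by (metis linorder_neqE_nat)
    then show ?thesis
    proof cases
      case 3
      have n: "nat (1 + int j) = Suc j" by simp
      have V: "(1 - q * q ^ j) * down_weight q e x (1 + int j) = (1 - x * e * q ^ j) * down_weight q e x (int j)"
        by (rule down_weight_rec[OF q(1)])
      have D: "(1 - x * e) * down_weight q e (q * x) (int j) = (1 - x * e * q ^ j) * down_weight q e x (int j)"
        by (rule down_weight_shift[OF q(1)])
      define I where "I = int a - int k + 1"
      have U: "up_weight q c (q * x) I = up_weight q c x I - x * up_weight q c x (int a - int k)"
        using up_weight_shift[OF q(1), of c x I] by (simp add: I_def)
      let ?N = "gap_weight q (c * e) (a - b)"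
      have "(\<Sum>t\<in>UNIV. row_factor q x c e t a b k * gauge q x x e t u (nat (int k - of_bool t - int b)))
         = ?N * (up_weight q c x I * ((1 - x * e * q ^ j) * down_weight q e x (int j))
            - x * up_weight q c x (int a - int k) * ((1 - q * q ^ j) * down_weight q e x (1 + int j)))"
        by (simp add: UNIV_bool row_factor_def gauge_def 3 n I_def algebra_simps)
      also have "\<dots> = ?N * (up_weight q c (q * x) I * ((1 - x * e) * down_weight q e (q * x) (int j)))"
        unfolding V D U by (simp add: algebra_simps)
      also have "\<dots> = (1 - x * e) * row_factor q (q * x) c e True a b k"
        by (simp add: row_factor_def 3 I_def)
      finally show ?thesis .
    qed (auto simp: UNIV_bool row_factor_def gauge_def)
  qed
  finally show ?thesis .
qed

lemma transfer_diagonal: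
  assumes "norm q < 1" "\<And>s. s < r \<Longrightarrow> norm (c s * d s) < 1" "\<And>s. s < r \<Longrightarrow> l (Suc s) \<le> l s"
  shows "transfer (\<lambda>r s t. strip_row_factor q x x (c r) (d r) s t (l r) (l (Suc r)) (k r)) r u
     = (\<Prod>s<r. (1 - x * d s) * row_factor q (q * x) (c s) (d s) True (l s) (l (Suc s)) (k s))"
  using assms
proof (induction r arbitrary: u)
  case (Suc r)
  then show ?case by (simp add: sum_strip_row_factor_diagonal flip: sum_distrib_left)
qed simp

lemma spin_whittaker_cong_vars:
  assumes "\<And>i. i < n \<Longrightarrow> x i = x' i"
  shows "spin_whittaker q n l x c d = spin_whittaker q n l x' c d"
  using assms
proof (induction n arbitrary: l c)
  case (Suc n)
  have "spin_whittaker q n m x c' d = spin_whittaker q n m x' c' d" for m c'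
    using Suc by simp
  then show ?case using Suc.prems[of n] by simp
qed simp

text \<open>
  By \<open>transfer_diagonal\<close> every coefficient factorises at \<open>z = x\<^sub>n\<close>, and the result is the
  branching rule with \<open>x\<^sub>n\<close> replaced by \<open>q x\<^sub>n\<close>, except that it involves \<open>F\<^bsub>\<mu> + (1,\<dots>,1)\<^esub>\<close>; this
  is where the product of the other variables comes from.
\<close>

lemma strip_sum_last:
  assumes q: "norm q < 1" and c: "c p = 0" and l: "l \<in> partitions (Suc p)"
    and cd: "\<And>r. r < p \<Longrightarrow> norm (c r) < 1" "\<And>r. r < p \<Longrightarrow> norm (d r) < 1"
  shows "q ^ l p * strip_sum q (x p) p True l x c d
     = (\<Prod>j\<le>p. x j) * (\<Prod>r<p. 1 - x p * d r) * spin_whittaker q (Suc p) l (x(p := q * x p)) c d"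
proof -
  let ?y = "x p" and ?c = "\<lambda>i. c (Suc i)"
  let ?f = "\<lambda>k. spin_whittaker q p k x ?c d"
  let ?B = "\<Prod>r<p. 1 - ?y * d r"
  let ?T = "\<lambda>k. \<Prod>r<p. row_factor q (q * ?y) (c r) (d r) False (l r) (l (Suc r)) (k r)"
  have decr: "l (Suc r) \<le> l r" for r using partitions_mono[OF l] by simp
  have "strip_sum q ?y p True l x c d = (\<Sum>k\<in>bounded_tuples p (Suc (l 0)). ?f k * (?y ^ (l p + 1)
     * (?B * (\<Prod>r<p. row_factor q (q * ?y) (c r) (d r) True (l r) (l (Suc r)) (k r)))))"
    by (subst strip_sum_eq_transfer[where c = c and p = p and l = l, OF q c l], subst transfer_diagonal)
      (use q cd decr norm_mult_less_1 in \<open>auto simp: prod.distrib\<close>)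
  also have "\<dots> = ?y ^ (l p + 1) * ?B * (\<Sum>k\<in>bounded_tuples p (Suc (l 0)).
     (if \<forall>r\<in>{..<p}. k r \<noteq> 0 then ?T (\<lambda>i. k i - of_bool (i \<in> {..<p})) else 0) * ?f k)"
  proof -
    have "(if \<forall>r\<in>{..<p}. k r \<noteq> 0 then ?T (\<lambda>i. k i - of_bool (i \<in> {..<p})) else 0)
      = (\<Prod>r<p. row_factor q (q * ?y) (c r) (d r) True (l r) (l (Suc r)) (k r))" for k
      using row_factors_remove_boxes[of "{..<p}" p k q "q * ?y" c d l] by (simp only: Int_absorb) simp
    then show ?thesis by (simp only: sum_distrib_left mult_ac)
  qed
  also have "\<dots> = ?y ^ (l p + 1) * ?B * (\<Sum>m\<in>bounded_tuples p (l 0). ?T m * ?f (add_boxes m {..<p}))"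
  proof (subst sum_bounded_tuples_shift)
    fix k i assume "i < p" "k i > l 0"
    then have "row_factor q (q * ?y) (c i) (d i) False (l i) (l (Suc i)) (k i) = 0"
      using partitions_mono[OF l, of 0 i] by (simp add: row_factor_def)
    then show "?T k = 0" using \<open>i < p\<close> by (auto intro: prod_zero)
  qed simp_all
  finally have "q ^ l p * strip_sum q ?y p True l x c d
     = ?y * ?B * (\<Sum>m\<in>bounded_tuples p (l 0). ?f (add_boxes m {..<p}) * row_weight q p (q * ?y) c d l m)"
    by (simp add: row_weight_def sum_distrib_left power_mult_distrib mult_ac)
  also have "(\<Sum>m\<in>bounded_tuples p (l 0). ?f (add_boxes m {..<p}) * row_weight q p (q * ?y) c d l m)
     = (\<Sum>m\<in>{m \<in> partitions p. interlaces m l}. ?f (add_boxes m {..<p}) * spin_skew q (Suc p) l m (q * ?y) c d)"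
    by (rule sum_skew_eq_sum_bounded_tuples[symmetric]) (use q c l partitions_mono[OF l] in \<open>auto simp: partitions_def\<close>)
  also have "\<dots> = (\<Sum>m\<in>{m \<in> partitions p. interlaces m l}. ((\<Prod>j<p. x j) * spin_whittaker q p m (x(p := q * ?y)) ?c d) * spin_skew q (Suc p) l m (q * ?y) c d)"
  proof (rule sum.cong)
    fix m assume "m \<in> {m \<in> partitions p. interlaces m l}"
    then have "?f (add_boxes m {..<p}) = (\<Prod>j<p. x j) * ?f m"
      by (intro spin_whittaker_add_column) (use q c cd in auto)
    also have "?f m = spin_whittaker q p m (x(p := q * ?y)) ?c d"
      by (rule spin_whittaker_cong_vars) simp
    finally show "?f (add_boxes m {..<p}) * spin_skew q (Suc p) l m (q * ?y) c d
      = ((\<Prod>j<p. x j) * spin_whittaker q p m (x(p := q * ?y)) ?c d) * spin_skew q (Suc p) l m (q * ?y) c d" by simp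
  qed simp
  finally show ?thesis
    by (simp add: sum_distrib_left mult_ac flip: lessThan_Suc_atMost)
qed

text \<open>
  For an earlier variable, \<open>C = z B\<close> holds one level down, by the Pieri rule at \<open>z = x\<^sub>i\<close>.  Using
  it to eliminate \<open>B\<close> from the recursion turns the factor \<open>q\<^bsup>\<lambda>\<^sub>n\<^esup>\<close> into \<open>q\<^bsup>\<mu>\<^bsub>n-1\<^esub>\<^esup>\<close>, and
  the induction hypothesis applies.
\<close>

theorem strip_sum_at_variable:
  assumes "norm q < 1" "c p = 0" "l \<in> partitions (Suc p)"
    and "\<And>r. r < p \<Longrightarrow> norm (c r) < 1" "\<And>r. r < p \<Longrightarrow> norm (d r) < 1" "i \<le> p"
  shows "q ^ l p * strip_sum q (x i) p True l x c d
     = (\<Prod>j\<le>p. x j) * (\<Prod>r<p. 1 - x i * d r) * spin_whittaker q (Suc p) l (x(i := q * x i)) c d"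
  using assms
proof (induction p arbitrary: l c)
  case 0
  then show ?case using strip_sum_last[of q c 0 l d x] by (simp only: le_zero_eq)
next
  case (Suc p)
  show ?case
  proof (cases "i = Suc p")
    case True
    then show ?thesis using strip_sum_last[of q c "Suc p" l d x] Suc.prems by (simp only:)
  next
    case False
    then have i: "i \<le> p" using Suc.prems by simp
    let ?z = "x i" and ?y = "x (Suc p)" and ?c = "\<lambda>i. c (Suc i)" and ?x = "x(i := q * x i)"
    let ?M = "{m \<in> partitions (Suc p). interlaces m l}"
    let ?SS = "\<lambda>m s. strip_sum q ?z p s m x ?c d"
    let ?K = "\<lambda>m. spin_skew q (Suc (Suc p)) l m ?y c d"
    let ?G = "\<lambda>m s. gauge q ?z ?y (d p) s True (m p - l (Suc p))"
    let ?P = "(\<Prod>j\<le>p. x j) * (\<Prod>r<p. 1 - ?z * d r)"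
    have "q ^ l (Suc p) * strip_sum q ?z (Suc p) True l x c d
       = ?y * (\<Sum>m\<in>?M. (q ^ l (Suc p) * (\<Sum>s\<in>UNIV. ?G m s * ?SS m s)) * ?K m)"
      by (subst strip_sum_Suc) (use Suc.prems in \<open>auto simp: sum_distrib_left mult_ac\<close>)
    also have "\<dots> = ?y * (\<Sum>m\<in>?M. (1 - ?z * d p) * (?P * spin_whittaker q (Suc p) m ?x ?c d) * ?K m)"
    proof (rule arg_cong[where f = "(*) ?y"], rule sum.cong)
      fix m assume m: "m \<in> ?M"
      then have "l (Suc p) \<le> m p" by (simp add: interlaces_def)
      then have pw: "q ^ l (Suc p) * q ^ (m p - l (Suc p)) = q ^ m p" by (simp flip: power_add)
      have "?SS m True - ?z * ?SS m False = (\<Prod>j\<le>p. x j - ?z) * spin_whittaker q (Suc p) m x ?c d"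
        by (rule prod_times_spin_whittaker[symmetric]) (use m Suc.prems in auto)
      also have "(\<Prod>j\<le>p. x j - ?z) = 0" using i by (intro prod_zero) auto
      finally have A: "?z * ?SS m False = ?SS m True" by simp
      have "q ^ l (Suc p) * (\<Sum>s\<in>UNIV. ?G m s * ?SS m s)
         = (q ^ l (Suc p) - ?z * d p * (q ^ l (Suc p) * q ^ (m p - l (Suc p)))) * ?SS m True
           - (q ^ l (Suc p) - q ^ l (Suc p) * q ^ (m p - l (Suc p))) * (?z * ?SS m False)"
        by (simp add: UNIV_bool gauge_def algebra_simps)
      also have "\<dots> = (1 - ?z * d p) * (q ^ m p * ?SS m True)"
        unfolding pw A by (simp add: algebra_simps)
      also have "q ^ m p * ?SS m True = ?P * spin_whittaker q (Suc p) m ?x ?c d"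
        by (rule Suc.IH) (use m i Suc.prems in auto)
      finally show "q ^ l (Suc p) * (\<Sum>s\<in>UNIV. ?G m s * ?SS m s) * ?K m
        = (1 - ?z * d p) * (?P * spin_whittaker q (Suc p) m ?x ?c d) * ?K m" by (simp only:)
    qed simp
    also have "\<dots> = (\<Prod>j\<le>Suc p. x j) * (\<Prod>r<Suc p. 1 - ?z * d r) * spin_whittaker q (Suc (Suc p)) l ?x c d"
      using i by (subst spin_whittaker.simps(2)) (simp add: sum_distrib_left mult_ac del: spin_whittaker.simps)
    finally show ?thesis .
  qed
qed

section \<open>Interpolation and the eigenvalue\<close>

lemma strip_sum_poly:
  obtains P where "degree P \<le> p" "\<And>z. poly P z = strip_sum q z p t l x c d"
proof -
  define b where "b r s u k = (if s then if u then [:1, - (d r * q ^ k):] else [:1 - c r * d r * q ^ k:]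
      else if u then [:0, q ^ k - 1:] else [:c r * q ^ k, - 1:])" for r s u k
  have b: "poly (b r s u k) z = box_weight q z (c r) (d r) s u k" "degree (b r s u k) \<le> 1" for r s u k z
    by (auto simp: b_def box_weight_def algebra_simps)
  define P where "P = (\<Sum>H\<in>strips p t. smult (spin_whittaker q (Suc p) (add_boxes l H) x c d)
     (\<Prod>r<p. b r (r \<in> H) (Suc r \<in> H) (l r - l (Suc r))))"
  show ?thesis
  proof
    have "degree (\<Prod>r<p. b r (r \<in> H) (Suc r \<in> H) (l r - l (Suc r))) \<le> p" for H
    proof -
      have "degree (\<Prod>r<p. b r (r \<in> H) (Suc r \<in> H) (l r - l (Suc r)))
        \<le> sum (degree \<circ> (\<lambda>r. b r (r \<in> H) (Suc r \<in> H) (l r - l (Suc r)))) {..<p}"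
        by (rule degree_prod_sum_le) simp
      also have "\<dots> \<le> (\<Sum>r<p. 1)" unfolding o_def by (intro sum_mono b)
      finally show ?thesis by simp
    qed
    then show "degree P \<le> p" unfolding P_def
      by (intro degree_sum_le order_trans[OF degree_smult_le]) auto
    show "poly P z = strip_sum q z p t l x c d" for z
      unfolding P_def strip_sum_def by (simp add: poly_sum poly_prod b mult.commute del: spin_whittaker.simps)
  qed
qed

lemma lagrange_at_0:
  fixes P :: "complex poly"
  assumes "degree P \<le> p" "inj_on x {..p}"
  shows "(\<Sum>i\<le>p. poly P (x i) * (\<Prod>j\<in>{..p} - {i}. x j / (x j - x i))) = poly P 0"
proof -
  define L where "L i = (\<Prod>j\<in>{..p} - {i}. smult (1 / (x j - x i)) [:x j, - 1:])" for i
  define R where "R = (\<Sum>i\<le>p. smult (poly P (x i)) (L i))"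
  have L: "poly (L i) z = (\<Prod>j\<in>{..p} - {i}. (x j - z) / (x j - x i))" for i z
    by (simp add: L_def poly_prod diff_divide_distrib)
  have "P = R"
  proof (rule poly_eqI_degree[where A = "x ` {..p}"])
    fix z assume "z \<in> x ` {..p}"
    then obtain k where k: "k \<le> p" "z = x k" by auto
    have "poly (L i) (x k) = (if i = k then 1 else 0)" if "i \<le> p" for i
    proof (cases "i = k")
      case True
      have "x j - x k \<noteq> 0" if "j \<in> {..p} - {k}" for j
        using assms(2) that k by (auto dest: inj_onD)
      then show ?thesis using True by (simp add: L)
    next
      case False
      then show ?thesis using k by (auto simp: L intro!: prod_zero)
    qed
    then have "poly R (x k) = (\<Sum>i\<le>p. poly P (x i) * (if i = k then 1 else 0))"
      unfolding R_def by (simp add: poly_sum)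
    also have "\<dots> = poly P (x k)" using k by (simp add: if_distrib[of "(*) _"] cong: if_cong)
    finally show "poly P z = poly R z" using k by simp
  next
    have card: "card (x ` {..p}) = Suc p" using assms(2) by (simp add: card_image)
    then show "card (x ` {..p}) > degree P" using assms(1) by simp
    have "degree (L i) \<le> p" if "i \<le> p" for i
    proof -
      have "degree (L i) \<le> sum (degree \<circ> (\<lambda>j. smult (1 / (x j - x i)) [:x j, - 1:])) ({..p} - {i})"
        unfolding L_def by (rule degree_prod_sum_le) simp
      also have "\<dots> \<le> (\<Sum>j\<in>{..p} - {i}. 1)" by (rule sum_mono) simp
      also have "\<dots> = p" using that by simp
      finally show ?thesis .
    qed
    then have "degree R \<le> p" unfolding R_def
      by (intro degree_sum_le order_trans[OF degree_smult_le]) auto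
    then show "card (x ` {..p}) > degree R" using card by simp
  qed
  then have "poly P 0 = poly R 0" by simp
  then show ?thesis by (simp add: R_def L poly_sum)
qed

theorem theorem3p1:
  fixes q :: complex and n :: nat and a b x :: "nat \<Rightarrow> complex" and l :: "nat \<Rightarrow> nat"
  assumes "norm q < 1"
    and "n \<ge> 1"
    and "\<And>r. r < n - 1 \<Longrightarrow> norm (a r) < 1"
    and "\<And>r. r < n - 1 \<Longrightarrow> norm (b r) < 1"
    and "l \<in> partitions n"
    and "\<And>i j. i < n \<Longrightarrow> j < n \<Longrightarrow> i \<noteq> j \<Longrightarrow> x j \<noteq> 0 \<and> x i \<noteq> x j"
  shows "q_difference q n b (\<lambda>y. spin_whittaker_f q n l y a b) x
       = q ^ l (n - 1) * spin_whittaker_f q n l x a b"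
proof -
  from \<open>n \<ge> 1\<close> obtain p where n: "n = Suc p" by (cases n) auto
  define c where "c = a(p := 0)"
  let ?F = "\<lambda>y. spin_whittaker q (Suc p) l y c b"
  let ?D = "\<Sum>i\<le>p. (\<Prod>r<p. 1 - x i * b r) * (\<Prod>j\<in>{..p} - {i}. 1 / (1 - x i / x j)) * ?F (x(i := q * x i))"
  have c: "c p = 0" "\<And>r. r < p \<Longrightarrow> norm (c r) < 1" and bn: "\<And>r. r < p \<Longrightarrow> norm (b r) < 1"
    and l: "l \<in> partitions (Suc p)"
    using assms n by (auto simp: c_def)
  have "?D = q ^ l p * ?F x"
  proof (cases "p = 0")
    case True
    have 1: "spin_whittaker q (Suc 0) l y c b = y 0 ^ l 0" for y
      using l c True assms(1) by (intro spin_whittaker_1) (auto simp: partitions_def)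
    show ?thesis using True by (simp add: 1 power_mult_distrib del: spin_whittaker.simps)
  next
    case False
    \<comment> \<open>The hypothesis needs a second index to say that \<open>x j\<close> is nonzero; with one variable, it may be 0.\<close>
    have nz: "x j \<noteq> 0" if "j \<le> p" for j
      using assms(6)[of "if j = 0 then 1 else 0" j] that False n by (auto split: if_splits)
    have inj: "inj_on x {..p}"
      using assms(6) n by (auto simp: inj_on_def less_Suc_eq_le)
    have X: "(\<Prod>j\<le>p. x j) \<noteq> 0" using nz by simp
    obtain P where P: "degree P \<le> p" "\<And>z. poly P z = strip_sum q z p True l x c b"
      using strip_sum_poly by blast
    have "(\<Prod>j\<le>p. x j) * ?D = (\<Sum>i\<le>p. q ^ l p * (poly P (x i) * (\<Prod>j\<in>{..p} - {i}. x j / (x j - x i))))"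
      unfolding sum_distrib_left
    proof (rule sum.cong)
      fix i assume i: "i \<in> {..p}"
      have "(\<Prod>j\<in>{..p} - {i}. 1 / (1 - x i / x j)) = (\<Prod>j\<in>{..p} - {i}. x j / (x j - x i))"
        by (rule prod.cong) (use nz in \<open>auto simp: divide_simps\<close>)
      then have "(\<Prod>j\<le>p. x j) * ((\<Prod>r<p. 1 - x i * b r) * (\<Prod>j\<in>{..p} - {i}. 1 / (1 - x i / x j)) * ?F (x(i := q * x i)))
        = ((\<Prod>j\<le>p. x j) * (\<Prod>r<p. 1 - x i * b r) * ?F (x(i := q * x i))) * (\<Prod>j\<in>{..p} - {i}. x j / (x j - x i))"
        by (simp only: mult_ac)
      also have "(\<Prod>j\<le>p. x j) * (\<Prod>r<p. 1 - x i * b r) * ?F (x(i := q * x i)) = q ^ l p * poly P (x i)"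
        unfolding P by (rule strip_sum_at_variable[symmetric]) (use assms(1) c bn l i in auto)
      finally show "(\<Prod>j\<le>p. x j) * ((\<Prod>r<p. 1 - x i * b r) * (\<Prod>j\<in>{..p} - {i}. 1 / (1 - x i / x j)) * ?F (x(i := q * x i)))
        = q ^ l p * (poly P (x i) * (\<Prod>j\<in>{..p} - {i}. x j / (x j - x i)))"
        by (simp only: mult.assoc)
    qed simp
    also have "\<dots> = q ^ l p * strip_sum q 0 p True l x c b"
      by (simp only: lagrange_at_0[OF P(1) inj] flip: sum_distrib_left P(2))
    also have "strip_sum q 0 p True l x c b = (\<Prod>j\<le>p. x j) * ?F x"
      using prod_times_spin_whittaker[of q c p l b x 0] assms(1) c bn l by (simp del: spin_whittaker.simps)
    finally have "(\<Prod>j\<le>p. x j) * ?D = (\<Prod>j\<le>p. x j) * (q ^ l p * ?F x)"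
      by (simp only: mult_ac)
    then show ?thesis by (rule mult_left_cancel[OF X, THEN iffD1])
  qed
  then show ?thesis
    by (simp add: n q_difference_def q_shift_def spin_whittaker_f_def c_def lessThan_Suc_atMost del: spin_whittaker.simps)
qed

end
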